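(* Let $a,b>0$ and consider the weight function $w_1(h,t)=t+a$, $w_0(h,t)=h+b$ on $\mathbb Z_+^2$ (the generalized Eulerian triangle), with $\mathcal P=\mathcal P(w)$. Then the measures $Q_{m,\infty}$ and $Q_{\infty,m}$ exist for all $m\ge0$, and together with $P^*$ they comprise the boundary: $$\mathrm{ext}\,\mathcal P=\{Q_{m,\infty}:m\ge0\}\cup\{Q_{\infty,m}:m\ge0\}\cup\{P^*\}.$$
   Context: Consider the lattice $\mathbb Z_+^2$ with directed edges $(h,t)\to(h+1,t)$ and $(h,t)\to(h,t+1)$, carrying strictly positive weights $w_1(h,t)$ and $w_0(h,t)$ respectively. A standard path starts at $(0,0)$ and moves along directed edges. The weight of a finite path is the product of the weights of its edges; $d(h,t)$ is the sum of the weights of all standard paths with endpoint $(h,t)$. $\mathcal P=\mathcal P(w)$ is the set of probability laws $P$ of random infinite standard paths $S=(S_n)_{n\ge 0}$, $S_n=(H_n,T_n)$, $H_n+T_n=n$, with the conditioning property: whenever $P(S_{h+t}=(h,t))>0$, given $S_{h+t}=(h,t)$ the conditional probability of each standard path with endpoint $(h,t)$ is the weight of that path divided by $d(h,t)$. $\mathcal P$ is convex; $\mathrm{ext}\,\mathcal P$ denotes its set of extreme points (the boundary). The probability function of $P\in\mathcal P$ is $\phi(h,t)=P(S_{h+t}=(h,t))/d(h,t)$. For $m\ge0$, $Q_{m,\infty}$ denotes the (unique, if it exists) measure in $\mathrm{ext}\,\mathcal P$ whose probability function is strictly positive on $\{(h,t):h\le m\}$ and zero elsewhere; $Q_{\infty,m}$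 denotes the (unique, if it exists) measure in $\mathrm{ext}\,\mathcal P$ whose probability function is strictly positive on $\{(h,t):t\le m\}$ and zero elsewhere. $P^*\in\mathcal P$ is the law of the Markov chain started at $(0,0)$ moving from $(h,t)$ to $(h+1,t)$ with probability $\frac{t+a}{h+t+a+b}$ and to $(h,t+1)$ with probability $\frac{h+b}{h+t+a+b}$. *)

theory Defs
  imports "HOL-Probability.Probability"
begin

subsection \<open>Weighted lattice paths\<close>

text \<open>Lattice points \<open>(h, t)\<close> are pairs of naturals. A weight function is a pair
  \<open>w1 w0 :: nat \<Rightarrow> nat \<Rightarrow> real\<close>: \<open>w1 h t\<close> is the weight of the edge from \<open>(h, t)\<close> to
  \<open>(h + 1, t)\<close>, and \<open>w0 h t\<close> is the weight of the edge from \<open>(h, t)\<close> to \<open>(h, t + 1)\<close>.\<close>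

definition edge :: "nat \<times> nat \<Rightarrow> nat \<times> nat \<Rightarrow> bool" where
  "edge x y \<longleftrightarrow> y = (fst x + 1, snd x) \<or> y = (fst x, snd x + 1)"

text \<open>Only meaningful for \<open>x\<close>, \<open>y\<close> with \<open>edge x y\<close>.\<close>

definition edge_weight ::
  "(nat \<Rightarrow> nat \<Rightarrow> real) \<Rightarrow> (nat \<Rightarrow> nat \<Rightarrow> real) \<Rightarrow> nat \<times> nat \<Rightarrow> nat \<times> nat \<Rightarrow> real" where
  "edge_weight w1 w0 x y =
     (if y = (fst x + 1, snd x) then w1 (fst x) (snd x) else w0 (fst x) (snd x))"

text \<open>A finite path is the list of the lattice points it visits, both ends included.\<close>

definition paths_to :: "nat \<times> nat \<Rightarrow> (nat \<times> nat) list set" where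
  "paths_to v = {xs. xs \<noteq> [] \<and> hd xs = (0, 0) \<and> last xs = v \<and> successively edge xs}"

definition path_weight ::
  "(nat \<Rightarrow> nat \<Rightarrow> real) \<Rightarrow> (nat \<Rightarrow> nat \<Rightarrow> real) \<Rightarrow> (nat \<times> nat) list \<Rightarrow> real" where
  "path_weight w1 w0 xs = (\<Prod>i<length xs - 1. edge_weight w1 w0 (xs ! i) (xs ! Suc i))"

definition d :: "(nat \<Rightarrow> nat \<Rightarrow> real) \<Rightarrow> (nat \<Rightarrow> nat \<Rightarrow> real) \<Rightarrow> nat \<Rightarrow> nat \<Rightarrow> real" where
  "d w1 w0 h t = (\<Sum>xs\<in>paths_to (h, t). path_weight w1 w0 xs)"

definition std_path :: "(nat \<Rightarrow> nat \<times> nat) \<Rightarrow> bool" where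
  "std_path S \<longleftrightarrow> S 0 = (0, 0) \<and> (\<forall>n. edge (S n) (S (Suc n)))"

text \<open>\<open>S\<close> starts with the finite sequence \<open>xs\<close>.\<close>

definition begins_with :: "(nat \<Rightarrow> 'a) \<Rightarrow> 'a list \<Rightarrow> bool" where
  "begins_with S xs \<longleftrightarrow> map S [0..<length xs] = xs"

text \<open>The sum defining \<open>d\<close> ranges over a finite set.\<close>

lemma edge_sum: "edge x y \<Longrightarrow> fst y + snd y = Suc (fst x + snd x)"
  by (auto simp: edge_def)

lemma path_coord_sum:
  "successively edge (x # xs) \<Longrightarrow> i \<le> length xs \<Longrightarrow>
    fst ((x # xs) ! i) + snd ((x # xs) ! i) = fst x + snd x + i"
proof (induction xs arbitrary: x i)
  case (Cons y ys)
  then have e: "fst y + snd y = Suc (fst x + snd x)" by (simp add: edge_sum)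
  show ?case
  proof (cases i)
    case (Suc j)
    then show ?thesis using Cons.IH[of y j] Cons.prems e by simp
  qed simp
qed simp

lemma length_paths_to:
  assumes "xs \<in> paths_to (h, t)" shows "length xs = Suc (h + t)"
proof -
  obtain ys where xs: "xs = (0, 0) # ys"
    using assms by (cases xs) (auto simp: paths_to_def)
  have "fst (last xs) + snd (last xs) = length ys"
    using path_coord_sum[of "(0, 0)" ys "length ys"] assms
    by (simp add: xs paths_to_def last_conv_nth del: last.simps)
  then show ?thesis using assms by (simp add: xs paths_to_def)
qed

lemma finite_paths_to: "finite (paths_to (h, t))"
proof (rule finite_subset)
  show "paths_to (h, t) \<subseteq> {xs. set xs \<subseteq> {..h+t} \<times> {..h+t} \<and> length xs = Suc (h + t)}"
  proof (safe, goal_cases)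
    case (1 xs p q)
    then obtain ys where xs: "xs = (0, 0) # ys" by (cases xs) (auto simp: paths_to_def)
    obtain i where i: "i < length xs" "xs ! i = (p, q)"
      using 1(2) by (auto simp: in_set_conv_nth)
    show ?case using path_coord_sum[of "(0,0)" ys i] i length_paths_to[OF 1(1)] 1(1)
      by (auto simp: xs paths_to_def)
  next
    case (2 xs p q)
    then obtain ys where xs: "xs = (0, 0) # ys" by (cases xs) (auto simp: paths_to_def)
    obtain i where i: "i < length xs" "xs ! i = (p, q)"
      using 2(2) by (auto simp: in_set_conv_nth)
    show ?case using path_coord_sum[of "(0,0)" ys i] i length_paths_to[OF 2(1)] 2(1)
      by (auto simp: xs paths_to_def)
  qed (auto dest: length_paths_to)
  show "finite {xs. set xs \<subseteq> {..h+t} \<times> {..h+t} \<and> length xs = Suc (h + t)}"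
    by (rule finite_lists_length_eq) auto
qed


subsection \<open>Laws of random infinite paths\<close>

definition seq_space :: "(nat \<Rightarrow> 'a) measure" where
  "seq_space = PiM UNIV (\<lambda>_. count_space UNIV)"

definition path_laws ::
  "(nat \<Rightarrow> nat \<Rightarrow> real) \<Rightarrow> (nat \<Rightarrow> nat \<Rightarrow> real) \<Rightarrow> (nat \<Rightarrow> nat \<times> nat) measure set" where
  "path_laws w1 w0 = {P. prob_space P \<and> sets P = sets seq_space \<and> (AE S in P. std_path S) \<and>
     (\<forall>h t. \<P>(S in P. S (h + t) = (h, t)) > 0 \<longrightarrow>
        (\<forall>xs\<in>paths_to (h, t).
           \<P>(S in P. begins_with S xs \<bar> S (h + t) = (h, t)) = path_weight w1 w0 xs / d w1 w0 h t))}"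

definition prob_fun ::
  "(nat \<Rightarrow> nat \<Rightarrow> real) \<Rightarrow> (nat \<Rightarrow> nat \<Rightarrow> real) \<Rightarrow> (nat \<Rightarrow> nat \<times> nat) measure \<Rightarrow> nat \<Rightarrow> nat \<Rightarrow> real"
  where "prob_fun w1 w0 P h t = \<P>(S in P. S (h + t) = (h, t)) / d w1 w0 h t"

text \<open>Measures do not form a real vector space in the library, so \<^const>\<open>extreme_point_of\<close> does
  not apply; this is its definition with convex combinations of measures taken setwise. All
  measures in the set are assumed to have the same sigma-algebra.\<close>

definition extreme_measures :: "'a measure set \<Rightarrow> 'a measure set" where
  "extreme_measures \<C> = {P \<in> \<C>. \<not> (\<exists>P1\<in>\<C>. \<exists>P2\<in>\<C>. P1 \<noteq> P2 \<and>
     (\<exists>u::real. 0 < u \<and> u < 1 \<and>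
        (\<forall>A\<in>sets P. measure P A = (1 - u) * measure P1 A + u * measure P2 A)))}"

definition is_Q_m_inf ::
  "(nat \<Rightarrow> nat \<Rightarrow> real) \<Rightarrow> (nat \<Rightarrow> nat \<Rightarrow> real) \<Rightarrow> nat \<Rightarrow> (nat \<Rightarrow> nat \<times> nat) measure \<Rightarrow> bool" where
  "is_Q_m_inf w1 w0 m Q \<longleftrightarrow> Q \<in> extreme_measures (path_laws w1 w0) \<and>
     (\<forall>h t. (h \<le> m \<longrightarrow> prob_fun w1 w0 Q h t > 0) \<and> (\<not> h \<le> m \<longrightarrow> prob_fun w1 w0 Q h t = 0))"

definition is_Q_inf_m ::
  "(nat \<Rightarrow> nat \<Rightarrow> real) \<Rightarrow> (nat \<Rightarrow> nat \<Rightarrow> real) \<Rightarrow> nat \<Rightarrow> (nat \<Rightarrow> nat \<times> nat) measure \<Rightarrow> bool" where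
  "is_Q_inf_m w1 w0 m Q \<longleftrightarrow> Q \<in> extreme_measures (path_laws w1 w0) \<and>
     (\<forall>h t. (t \<le> m \<longrightarrow> prob_fun w1 w0 Q h t > 0) \<and> (\<not> t \<le> m \<longrightarrow> prob_fun w1 w0 Q h t = 0))"

definition Q_m_inf ::
  "(nat \<Rightarrow> nat \<Rightarrow> real) \<Rightarrow> (nat \<Rightarrow> nat \<Rightarrow> real) \<Rightarrow> nat \<Rightarrow> (nat \<Rightarrow> nat \<times> nat) measure" where
  "Q_m_inf w1 w0 m = (THE Q. is_Q_m_inf w1 w0 m Q)"

definition Q_inf_m ::
  "(nat \<Rightarrow> nat \<Rightarrow> real) \<Rightarrow> (nat \<Rightarrow> nat \<Rightarrow> real) \<Rightarrow> nat \<Rightarrow> (nat \<Rightarrow> nat \<times> nat) measure" where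
  "Q_inf_m w1 w0 m = (THE Q. is_Q_inf_m w1 w0 m Q)"


subsection \<open>Laws of Markov chains\<close>

definition is_markov_chain_law :: "'a \<Rightarrow> ('a \<Rightarrow> 'a pmf) \<Rightarrow> (nat \<Rightarrow> 'a) measure \<Rightarrow> bool" where
  "is_markov_chain_law x0 K P \<longleftrightarrow>
     prob_space P \<and> sets P = sets seq_space \<and> (AE S in P. S 0 = x0) \<and>
     (\<forall>xs y. xs \<noteq> [] \<longrightarrow> \<P>(S in P. begins_with S xs) > 0 \<longrightarrow>
        \<P>(S in P. S (length xs) = y \<bar> begins_with S xs) = pmf (K (last xs)) y)"

definition markov_chain_law :: "'a \<Rightarrow> ('a \<Rightarrow> 'a pmf) \<Rightarrow> (nat \<Rightarrow> 'a) measure" where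
  "markov_chain_law x0 K = (THE P. is_markov_chain_law x0 K P)"

text \<open>The description is proper on a countable state space: such a law exists and is unique. For
  existence, take independent moves \<open>\<omega> (n, x)\<close> with law \<open>K x\<close>, and follow \<open>\<omega> (n, x)\<close> when at \<open>x\<close>
  at time \<open>n\<close>.\<close>

lemma begins_with_iff: "begins_with S xs \<longleftrightarrow> (\<forall>i<length xs. S i = xs ! i)"
  unfolding begins_with_def by (subst list_eq_iff_nth_eq) auto

lemma begins_with_snoc: "begins_with S (xs @ [y]) \<longleftrightarrow> S (length xs) = y \<and> begins_with S xs"
  by (auto simp: begins_with_def)

lemma space_seq_space[simp]: "space (seq_space :: (nat \<Rightarrow> 'a) measure) = UNIV"
  by (auto simp: seq_space_def space_PiM)

lemma measurable_seq_space_nth[measurable]: "(\<lambda>S. S i) \<in> seq_space \<rightarrow>\<^sub>M count_space UNIV"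
  unfolding seq_space_def by (rule measurable_component_singleton) simp

lemma measurable_seq_space_prefix:
  "(\<lambda>S :: nat \<Rightarrow> 'a::countable. map S [0..<n]) \<in> seq_space \<rightarrow>\<^sub>M count_space UNIV"
proof (induction n)
  case (Suc n)
  have "(\<lambda>S :: nat \<Rightarrow> 'a. (map S [0..<n], S n)) \<in> seq_space \<rightarrow>\<^sub>M count_space UNIV \<Otimes>\<^sub>M count_space UNIV"
    by (intro measurable_Pair Suc.IH measurable_seq_space_nth)
  then have "(\<lambda>S :: nat \<Rightarrow> 'a. (map S [0..<n], S n)) \<in> seq_space \<rightarrow>\<^sub>M count_space UNIV"
    by (simp add: pair_measure_countable)
  from measurable_compose[OF this, of "\<lambda>(xs, x). xs @ [x]" "count_space UNIV"]
  show ?case by simp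
qed simp

lemma measurable_begins_with[measurable]:
  "Measurable.pred seq_space (\<lambda>S :: nat \<Rightarrow> 'a::countable. begins_with S xs)"
  unfolding begins_with_iff by measurable

lemma markov_chain_law_cylinder:
  fixes P :: "(nat \<Rightarrow> 'a::countable) measure"
  assumes P: "is_markov_chain_law x0 K P" and "xs \<noteq> []"
  shows "\<P>(S in P. begins_with S xs) =
    (if hd xs = x0 then \<Prod>i<length xs - 1. pmf (K (xs ! i)) (xs ! Suc i) else 0)"
  using \<open>xs \<noteq> []\<close>
proof (induction xs rule: rev_nonempty_induct)
  interpret prob_space P using P by (simp add: is_markov_chain_law_def)
  have sets[measurable_cong]: "sets P = sets seq_space"
    using P by (simp add: is_markov_chain_law_def)
  {
    case (single x)
    have "\<P>(S in P. begins_with S [x]) = \<P>(S in P. x0 = x)"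
      by (rule prob_eq_AE) (use P in \<open>auto simp: begins_with_iff is_markov_chain_law_def\<close>)
    then show ?case by (simp add: prob_space)
  next
    case (snoc y xs)
    note * = begins_with_snoc
    have "\<P>(S in P. begins_with S (xs @ [y]))
        = \<P>(S in P. begins_with S xs) * pmf (K (last xs)) y"
    proof (cases "\<P>(S in P. begins_with S xs) > 0")
      case True
      then show ?thesis using P snoc.hyps
        by (simp add: is_markov_chain_law_def cond_prob_def * field_simps)
    next
      case False
      then have "\<P>(S in P. begins_with S xs) = 0"
        using measure_nonneg[of P "{S \<in> space P. begins_with S xs}"] by linarith
      moreover have "\<P>(S in P. begins_with S (xs @ [y])) \<le> \<P>(S in P. begins_with S xs)"
        by (rule finite_measure_mono) (auto simp: *)
      ultimately show ?thesis
        using measure_nonneg[of P "{S \<in> space P. begins_with S (xs @ [y])}"] by simp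
    qed
    moreover have "(\<Prod>i<length xs. pmf (K ((xs @ [y]) ! i)) ((xs @ [y]) ! Suc i)) =
      (\<Prod>i<length xs - 1. pmf (K (xs ! i)) (xs ! Suc i)) * pmf (K (last xs)) y"
    proof -
      obtain k where k: "length xs = Suc k" using snoc.hyps by (cases xs) auto
      then show ?thesis using snoc.hyps
        by (simp add: nth_append last_conv_nth)
    qed
    ultimately show ?case using snoc by simp
  }
qed

lemma markov_chain_law_unique:
  fixes P Q :: "(nat \<Rightarrow> 'a::countable) measure"
  assumes P: "is_markov_chain_law x0 K P" and Q: "is_markov_chain_law x0 K Q"
  shows "P = Q"
proof (rule measure_eqI_PiM_infinite[of _ "UNIV :: nat set" "\<lambda>_. count_space UNIV :: 'a measure"])
  interpret P: prob_space P using P by (simp add: is_markov_chain_law_def)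
  interpret Q: prob_space Q using Q by (simp add: is_markov_chain_law_def)
  have sP[measurable_cong]: "sets P = sets seq_space"
    and sQ[measurable_cong]: "sets Q = sets seq_space"
    using P Q by (auto simp: is_markov_chain_law_def)
  show "sets P = sets (PiM UNIV (\<lambda>_. count_space UNIV))"
    "sets Q = sets (PiM UNIV (\<lambda>_. count_space UNIV))"
    using sP sQ by (auto simp: seq_space_def)
  show "finite_measure P" by (rule P.finite_measure_axioms)
  fix A :: "nat \<Rightarrow> 'a set" and J :: "nat set"
  assume J: "finite J"
  define n where "n = Suc (Max (insert 0 J))"
  have n: "j < n" if "j \<in> J" for j using J that by (simp add: n_def less_Suc_eq_le)
  have eq: "distr P (count_space UNIV) (\<lambda>S. map S [0..<n]) =
    distr Q (count_space UNIV) (\<lambda>S. map S [0..<n])" (is "?P = ?Q")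
  proof (rule measure_eqI_countable)
    note pre = measurable_seq_space_prefix[of n]
    have mP: "(\<lambda>S. map S [0..<n]) \<in> P \<rightarrow>\<^sub>M count_space UNIV"
      and mQ: "(\<lambda>S. map S [0..<n]) \<in> Q \<rightarrow>\<^sub>M count_space UNIV"
      using pre by (auto simp: measurable_cong_sets[OF sP refl] measurable_cong_sets[OF sQ refl])
    fix xs :: "'a list"
    show "emeasure ?P {xs} = emeasure ?Q {xs}"
    proof (cases "length xs = n")
      case True
      then have "xs \<noteq> []" by (auto simp: n_def)
      have *: "(\<lambda>S. map S [0..<n]) -` {xs} = {S. begins_with S xs}"
        using True by (auto simp: begins_with_def)
      show ?thesis
        using markov_chain_law_cylinder[OF P \<open>xs \<noteq> []\<close>] markov_chain_law_cylinder[OF Q \<open>xs \<noteq> []\<close>]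
        by (simp add: emeasure_distr mP mQ * P.emeasure_eq_measure Q.emeasure_eq_measure
            Collect_conj_eq Int_commute)
    next
      case False
      then have "(\<lambda>S. map S [0..<n]) -` {xs} = {}" by auto
      then show ?thesis by (simp add: emeasure_distr mP mQ)
    qed
  qed (auto intro: countableI_type)
  define B where "B = {xs. length xs = n \<and> (\<forall>j\<in>J. xs ! j \<in> A j)}"
  have *: "prod_emb UNIV (\<lambda>_. count_space UNIV) J (Pi\<^sub>E J A) = (\<lambda>S. map S [0..<n]) -` B"
    using n by (auto simp: prod_emb_def B_def PiE_iff)
  have "emeasure ?P B = emeasure ?Q B" by (simp add: eq)
  moreover have "emeasure ?P B = emeasure P ((\<lambda>S. map S [0..<n]) -` B)"
    using measurable_seq_space_prefix[of n] sets_eq_imp_space_eq[OF sP]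
    by (subst emeasure_distr) (auto simp: measurable_cong_sets[OF sP refl])
  moreover have "emeasure ?Q B = emeasure Q ((\<lambda>S. map S [0..<n]) -` B)"
    using measurable_seq_space_prefix[of n] sets_eq_imp_space_eq[OF sQ]
    by (subst emeasure_distr) (auto simp: measurable_cong_sets[OF sQ refl])
  ultimately show "emeasure P (prod_emb UNIV (\<lambda>_. count_space UNIV) J (Pi\<^sub>E J A)) =
      emeasure Q (prod_emb UNIV (\<lambda>_. count_space UNIV) J (Pi\<^sub>E J A))"
    by (simp add: *)
qed

lemma markov_chain_law_exists:
  fixes K :: "'a::countable \<Rightarrow> 'a pmf"
  shows "\<exists>P. is_markov_chain_law x0 K P"
proof -
  define M where "M = (\<lambda>i :: nat \<times> 'a. measure_pmf (K (snd i)))"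
  define X where "X = (\<lambda>\<omega> :: nat \<times> 'a \<Rightarrow> 'a. rec_nat x0 (\<lambda>n x. \<omega> (n, x)))"
  have X_simps: "X \<omega> 0 = x0" "X \<omega> (Suc n) = \<omega> (n, X \<omega> n)" for \<omega> n
    by (simp_all add: X_def)
  interpret MM: product_prob_space M UNIV
    by (simp add: product_prob_space_def product_prob_space_axioms_def product_sigma_finite_def
        M_def prob_space_measure_pmf prob_space_imp_sigma_finite)
  have comp: "(\<lambda>\<omega>. \<omega> i) \<in> PiM UNIV M \<rightarrow>\<^sub>M count_space UNIV" for i
    using measurable_component_singleton[of i UNIV M] by (simp add: M_def)
  have Xn: "(\<lambda>\<omega>. X \<omega> n) \<in> PiM UNIV M \<rightarrow>\<^sub>M count_space UNIV" for n
  proof (induction n)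
    case (Suc n)
    show ?case unfolding X_simps
      by (rule measurable_compose_countable[OF comp Suc.IH])
  qed (simp add: X_simps)
  have X[measurable]: "X \<in> PiM UNIV M \<rightarrow>\<^sub>M seq_space"
    unfolding seq_space_def using Xn by (intro measurable_PiM_single') (auto simp: space_PiM)
  define P where "P = distr (PiM UNIV M) seq_space X"
  interpret P: prob_space P
    unfolding P_def by (rule prob_space.prob_space_distr[OF prob_space_PiM X]) (simp add: M_def prob_space_measure_pmf)
  have cyl: "\<P>(S in P. begins_with S (x0 # xs)) = (\<Prod>i<length xs. pmf (K ((x0 # xs) ! i)) (xs ! i))"
    for xs
  proof -
    let ?f = "\<lambda>i. (i, (x0 # xs) ! i)"
    let ?J = "?f ` {..<length xs}"
    have "begins_with (X \<omega>) (x0 # xs) \<longleftrightarrow> (\<forall>j\<in>?J. \<omega> j \<in> {xs ! fst j})" (is "?l = ?r") for \<omega>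
    proof
      assume l: ?l
      show ?r
      proof clarsimp
        fix i assume i: "i < length xs"
        have "X \<omega> i = (x0 # xs) ! i" "X \<omega> (Suc i) = (x0 # xs) ! Suc i"
          using l i by (auto simp: begins_with_iff simp del: nth_Cons_Suc)
        then show "\<omega> (i, (x0 # xs) ! i) = xs ! i" by (simp add: X_simps)
      qed
    next
      assume r: ?r
      have "i \<le> length xs \<Longrightarrow> X \<omega> i = (x0 # xs) ! i" for i
        by (induction i) (use r in \<open>auto simp: X_simps\<close>)
      then show ?l by (auto simp: begins_with_iff less_Suc_eq_le)
    qed
    then have "\<P>(S in P. begins_with S (x0 # xs)) =
      measure (PiM UNIV M) {\<omega> \<in> space (PiM UNIV M). \<forall>j\<in>?J. \<omega> j \<in> {xs ! fst j}}"
      unfolding P_def using measurable_begins_with[of "x0 # xs"]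
    by (subst measure_distr) (auto intro!: arg_cong[where f="measure _"] simp: pred_def)
    also have "\<dots> = (\<Prod>j\<in>?J. measure (M j) {xs ! fst j})"
      unfolding measure_def[of "PiM UNIV M"]
      by (subst MM.emeasure_PiM_Collect)
        (auto simp: M_def measure_pmf.emeasure_eq_measure prod_ennreal prod_nonneg)
    also have "\<dots> = (\<Prod>i<length xs. pmf (K ((x0 # xs) ! i)) (xs ! i))"
      by (subst prod.reindex) (auto simp: inj_on_def M_def pmf.rep_eq)
    finally show ?thesis .
  qed
  have sP[measurable_cong]: "sets P = sets seq_space" by (simp add: P_def)
  have start: "AE S in P. S 0 = x0"
    unfolding P_def
    using measurable_sets[OF measurable_seq_space_nth[of 0], of "{x0}"]
    by (subst AE_distr_iff) (auto simp: X_simps vimage_def)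
  have "\<P>(S in P. S (length xs) = y \<bar> begins_with S xs) = pmf (K (last xs)) y"
    if "xs \<noteq> []" and pos: "\<P>(S in P. begins_with S xs) > 0" for xs y
  proof -
    have "hd xs = x0"
    proof (rule ccontr)
      assume "hd xs \<noteq> x0"
      have "\<P>(S in P. begins_with S xs) = \<P>(S in P. False)"
      proof (rule P.prob_eq_AE)
        have "\<not> begins_with S xs" if "S 0 = x0" for S
          using that \<open>xs \<noteq> []\<close> \<open>hd xs \<noteq> x0\<close> by (auto simp: begins_with_iff hd_conv_nth)
        then show "AE S in P. begins_with S xs \<longleftrightarrow> False"
          by (intro eventually_mono[OF start]) simp
      qed simp_all
      with pos show False by simp
    qed
    with that obtain zs where xs: "xs = x0 # zs" by (cases xs) auto
    have *: "S (length xs) = y \<and> begins_with S xs \<longleftrightarrow> begins_with S (x0 # (zs @ [y]))" for S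
      using begins_with_snoc[of S xs y] by (simp add: xs conj_commute)
    have "(\<Prod>i<Suc (length zs). pmf (K ((x0 # (zs @ [y])) ! i)) ((zs @ [y]) ! i)) =
      (\<Prod>i<length zs. pmf (K ((x0 # zs) ! i)) (zs ! i)) * pmf (K (last xs)) y"
    proof -
      have "(x0 # (zs @ [y])) ! i = (x0 # zs) ! i" if "i \<le> length zs" for i
        using that nth_append[of "x0 # zs" "[y]" i] by simp
      then show ?thesis by (simp add: nth_append xs last_conv_nth del: last.simps)
    qed
    then have eq: "\<P>(S in P. begins_with S (x0 # (zs @ [y]))) =
        \<P>(S in P. begins_with S xs) * pmf (K (last xs)) y"
      unfolding xs cyl by simp
    show ?thesis
      unfolding cond_prob_def * eq
      by (rule nonzero_mult_div_cancel_left) (rule less_imp_neq[OF pos, symmetric])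
  qed
  then have "is_markov_chain_law x0 K P"
    using start sP P.prob_space_axioms by (auto simp: is_markov_chain_law_def)
  then show ?thesis ..
qed

lemma is_markov_chain_law_markov_chain_law:
  fixes K :: "'a::countable \<Rightarrow> 'a pmf"
  shows "is_markov_chain_law x0 K (markov_chain_law x0 K)"
  unfolding markov_chain_law_def
proof (rule theI')
  show "\<exists>!P. is_markov_chain_law x0 K P"
    using markov_chain_law_exists[of x0 K] by (auto intro: markov_chain_law_unique)
qed


subsection \<open>The generalized Eulerian triangle\<close>

definition euler_w1 :: "real \<Rightarrow> nat \<Rightarrow> nat \<Rightarrow> real" where
  "euler_w1 a h t = real t + a"

definition euler_w0 :: "real \<Rightarrow> nat \<Rightarrow> nat \<Rightarrow> real" where
  "euler_w0 b h t = real h + b"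

definition euler_step :: "real \<Rightarrow> real \<Rightarrow> nat \<times> nat \<Rightarrow> (nat \<times> nat) pmf" where
  "euler_step a b = (\<lambda>(h, t). map_pmf (\<lambda>right. if right then (h + 1, t) else (h, t + 1))
     (bernoulli_pmf ((real t + a) / (real h + real t + a + b))))"

definition P_star :: "real \<Rightarrow> real \<Rightarrow> (nat \<Rightarrow> nat \<times> nat) measure" where
  "P_star a b = markov_chain_law (0, 0) (euler_step a b)"

lemma pmf_euler_step:
  assumes "a > 0" "b > 0"
  shows "pmf (euler_step a b (h, t)) (h + 1, t) = (real t + a) / (real h + real t + a + b)"
    and "pmf (euler_step a b (h, t)) (h, t + 1) = (real h + b) / (real h + real t + a + b)"
proof -
  let ?p = "(real t + a) / (real h + real t + a + b)"
  let ?g = "\<lambda>right. if right then (h + 1, t) else (h, t + 1)"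
  have p: "0 \<le> ?p" "?p \<le> 1" using assms by auto
  have inj: "inj ?g" by (auto simp: inj_def)
  have "pmf (euler_step a b (h, t)) (?g True) = ?p"
    unfolding euler_step_def prod.case pmf_map_inj'[OF inj] using p by simp
  then show "pmf (euler_step a b (h, t)) (h + 1, t) = ?p" by simp
  have "pmf (euler_step a b (h, t)) (?g False) = 1 - ?p"
    unfolding euler_step_def prod.case pmf_map_inj'[OF inj] using p by simp
  also have "\<dots> = (real h + b) / (real h + real t + a + b)"
    using assms by (simp add: field_simps)
  finally show "pmf (euler_step a b (h, t)) (h, t + 1) =
    (real h + b) / (real h + real t + a + b)" by simp
qed

end

theory Submission
  imports Defs
begin

text \<open>A law in \<open>\<P>\<close> is determined by its probability function, which can be any nonnegative
  solution \<open>\<phi>\<close> of \<open>\<phi>(h,t) = w\<^sub>1(h,t) \<phi>(h+1,t) + w\<^sub>0(h,t) \<phi>(h,t+1)\<close> with \<open>\<phi>(0,0) = 1\<close>; so the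
  extreme solutions have to be found. For the Eulerian weights and \<open>c = a + b\<close>,
  explicit solutions are \<open>\<phi>*(h,t) = 1/(c)\<^sub>h\<^sub>+\<^sub>t\<close>, where \<open>(c)\<^sub>n\<close> is the Pochhammer symbol, and
  \<open>\<phi>\<^sub>m(h,t) = m! (c)\<^sub>m\<^sub>+\<^sub>t / ((m-h)! (c)\<^sub>h\<^sub>+\<^sub>t (c)\<^sub>m (m+b)\<^sup>h\<^sup>+\<^sup>t)\<close> for \<open>h \<le> m\<close>, supported on \<open>h \<le> m\<close>.

  Along the column \<open>h = m\<close> the numbers \<open>\<phi>(m,t)(m+b)\<^sup>t\<close> decrease to a limit \<open>L\<close>, and by a maximum
  principle \<open>\<phi>\<close> dominates a positive multiple of \<open>\<phi>\<^sub>m\<close> if \<open>L > 0\<close>. An extreme \<open>\<phi>\<close> is therefore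
  some \<open>\<phi>\<^sub>m\<close>, the mirror image of such a function, or all its column and row limits vanish. In the last
  case the path leaves every column and row. The conditional probability, given
  \<open>S\<^sub>n = (h,n-h)\<close>, that the first step goes to the right increases with \<open>h\<close>. As \<open>\<phi>\<^sub>m\<close> charges only
  points with \<open>h \<le> m\<close>, that probability, divided by \<open>a\<close>, is at least \<open>\<phi>\<^sub>m(1,0) = m/(c(m+b))\<close> at \<open>h = m\<close>.
  Letting \<open>m\<close> tend to infinity gives \<open>\<phi>(1,0) \<ge> 1/c\<close> and, by symmetry, \<open>\<phi>(0,1) \<ge> 1/c\<close>. Both are
  equalities because \<open>a \<phi>(1,0) + b \<phi>(0,1) = 1\<close>. Shifting the origin, which replaces \<open>(a,b)\<close> by
  \<open>(a,b+1)\<close> or \<open>(a+1,b)\<close>, and iterating gives \<open>\<phi> = \<phi>*\<close>.\<close>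

subsection \<open>Laws and harmonic functions\<close>

definition harmonic ::
  "(nat \<Rightarrow> nat \<Rightarrow> real) \<Rightarrow> (nat \<Rightarrow> nat \<Rightarrow> real) \<Rightarrow> (nat \<Rightarrow> nat \<Rightarrow> real) \<Rightarrow> bool" where
  "harmonic w1 w0 \<phi> \<longleftrightarrow> (\<forall>h t. 0 \<le> \<phi> h t) \<and> \<phi> 0 0 = 1 \<and>
     (\<forall>h t. \<phi> h t = w1 h t * \<phi> (Suc h) t + w0 h t * \<phi> h (Suc t))"

text \<open>Shaped like \<open>extreme_measures\<close>, with pointwise convex combinations, so that
  decompositions of a law and of its probability function correspond.\<close>

definition extreme_harmonic ::
  "(nat \<Rightarrow> nat \<Rightarrow> real) \<Rightarrow> (nat \<Rightarrow> nat \<Rightarrow> real) \<Rightarrow> (nat \<Rightarrow> nat \<Rightarrow> real) \<Rightarrow> bool" where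
  "extreme_harmonic w1 w0 \<phi> \<longleftrightarrow> harmonic w1 w0 \<phi> \<and>
     (\<forall>\<phi>1 \<phi>2 u. harmonic w1 w0 \<phi>1 \<longrightarrow> harmonic w1 w0 \<phi>2 \<longrightarrow> 0 < u \<longrightarrow> u < 1 \<longrightarrow>
        (\<forall>h t. \<phi> h t = (1 - u) * \<phi>1 h t + u * \<phi>2 h t) \<longrightarrow> \<phi>1 = \<phi>2)"

lemma harmonicD:
  assumes "harmonic w1 w0 \<phi>"
  shows "0 \<le> \<phi> h t" "\<phi> 0 0 = 1"
    "\<phi> h t = w1 h t * \<phi> (Suc h) t + w0 h t * \<phi> h (Suc t)"
  using assms unfolding harmonic_def by blast+

section \<open>Finite paths as prefixes of infinite ones\<close>

lemma path_weight_single [simp]: "path_weight w1 w0 [x] = 1"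
  by (simp add: path_weight_def)

lemma path_weight_snoc:
  assumes "xs \<noteq> []"
  shows "path_weight w1 w0 (xs @ [y]) = path_weight w1 w0 xs * edge_weight w1 w0 (last xs) y"
proof -
  obtain k where "length xs = Suc k" using assms by (cases xs) auto
  then show ?thesis using assms by (simp add: path_weight_def nth_append last_conv_nth)
qed

lemma paths_to_nonempty: "paths_to (h, t) \<noteq> {}"
proof -
  \<comment> \<open>First \<open>h\<close> steps to the right, then \<open>t\<close> steps
    up.\<close>
  let ?xs = "map (\<lambda>i. (min i h, i - min i h)) [0..<Suc (h + t)]"
  have "hd ?xs = (0, 0)" by (simp add: hd_map hd_upt del: upt_Suc)
  moreover have "last ?xs = (h, t)" by simp
  moreover have "successively edge ?xs"
    by (auto simp: successively_conv_nth edge_def min_def simp del: upt_Suc)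
  ultimately have "?xs \<in> paths_to (h, t)" by (auto simp: paths_to_def)
  then show ?thesis by blast
qed

lemma std_path_begins_with:
  assumes "std_path S" "begins_with S xs" "xs \<noteq> []"
  shows "hd xs = (0, 0) \<and> successively edge xs"
proof -
  have "xs ! i = S i" if "i < length xs" for i
    using assms(2) that by (simp add: begins_with_iff)
  then show ?thesis
    using assms(1,3) by (auto simp: std_path_def hd_conv_nth successively_conv_nth)
qed

lemma std_path_prefix_in_paths_to:
  assumes "std_path S" "S (h + t) = (h, t)"
  shows "map S [0..<Suc (h + t)] \<in> paths_to (h, t)"
proof -
  have "begins_with S (map S [0..<Suc (h + t)])" by (simp add: begins_with_def del: upt_Suc)
  then show ?thesis
    using std_path_begins_with[OF assms(1)] assms(2) by (auto simp: paths_to_def)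
qed

lemma begins_with_paths_to_endpoint:
  assumes "xs \<in> paths_to (h, t)" "begins_with S xs"
  shows "S (h + t) = (h, t)"
  using assms length_paths_to[OF assms(1)]
  by (auto simp: begins_with_iff paths_to_def last_conv_nth)

section \<open>Probabilities of prefixes\<close>

text \<open>The conditioning property forces this value: the endpoint has probability
  \<open>d * \<phi>\<close>, and a given path to it has conditional probability
  \<open>path_weight / d\<close>. Lists that are not paths from the origin get 0.\<close>

definition cylinder_prob ::
  "(nat \<Rightarrow> nat \<Rightarrow> real) \<Rightarrow> (nat \<Rightarrow> nat \<Rightarrow> real) \<Rightarrow> (nat \<Rightarrow> nat \<Rightarrow> real) \<Rightarrow> (nat \<times> nat) list \<Rightarrow> real" where
  "cylinder_prob w1 w0 \<phi> xs = (if hd xs = (0, 0) \<and> successively edge xs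
     then path_weight w1 w0 xs * \<phi> (fst (last xs)) (snd (last xs)) else 0)"

definition cylinder_law ::
  "(nat \<Rightarrow> nat \<Rightarrow> real) \<Rightarrow> (nat \<Rightarrow> nat \<Rightarrow> real) \<Rightarrow> (nat \<Rightarrow> nat \<Rightarrow> real) \<Rightarrow>
    (nat \<Rightarrow> nat \<times> nat) measure \<Rightarrow> bool" where
  "cylinder_law w1 w0 \<phi> P \<longleftrightarrow> prob_space P \<and> sets P = sets seq_space \<and>
     (\<forall>xs. xs \<noteq> [] \<longrightarrow> \<P>(S in P. begins_with S xs) = cylinder_prob w1 w0 \<phi> xs)"

text \<open>Doob transform of the weights by \<open>\<phi>\<close>; the recursion makes the
  complementary probability that of the step up. Where \<open>\<phi> h t = 0\<close> the quotient is
  0 and the step goes up; such points are reached with probability 0.\<close>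

definition harmonic_step ::
  "(nat \<Rightarrow> nat \<Rightarrow> real) \<Rightarrow> (nat \<Rightarrow> nat \<Rightarrow> real) \<Rightarrow> nat \<times> nat \<Rightarrow> (nat \<times> nat) pmf" where
  "harmonic_step w1 \<phi> = (\<lambda>(h, t). map_pmf (\<lambda>right. if right then (h + 1, t) else (h, t + 1))
     (bernoulli_pmf (w1 h t * \<phi> (Suc h) t / \<phi> h t)))"

text \<open>Almost surely the event is the union of the cylinders of the finitely many paths to
  \<open>(h, t)\<close>, which are disjoint because these paths have equal length.\<close>

lemma endpoint_prob:
  assumes "prob_space P" and sets: "sets P = sets seq_space" and AE: "AE S in P. std_path S"
  shows "\<P>(S in P. S (h + t) = (h, t)) = (\<Sum>xs\<in>paths_to (h, t). \<P>(S in P. begins_with S xs))"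
proof -
  interpret prob_space P by fact
  note [measurable_cong] = sets
  have meas: "{S \<in> space P. begins_with S xs} \<in> sets P" for xs by measurable
  have U: "(\<Union>xs\<in>paths_to (h, t). {S \<in> space P. begins_with S xs}) \<in> sets P"
    by (intro sets.finite_UN finite_paths_to meas)
  have "\<P>(S in P. S (h + t) = (h, t)) =
      prob (\<Union>xs\<in>paths_to (h, t). {S \<in> space P. begins_with S xs})"
  proof (rule finite_measure_eq_AE)
    show "AE S in P. S \<in> {S \<in> space P. S (h + t) = (h, t)} \<longleftrightarrow>
        S \<in> (\<Union>xs\<in>paths_to (h, t). {S \<in> space P. begins_with S xs})"
      using AE
    proof eventually_elim
      case (elim S)
      have "begins_with S (map S [0..<Suc (h + t)])" by (simp add: begins_with_def del: upt_Suc)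
      then show ?case
        using std_path_prefix_in_paths_to[OF elim, of h t] begins_with_paths_to_endpoint by blast
    qed
    show "{S \<in> space P. S (h + t) = (h, t)} \<in> sets P" by measurable
  qed (rule U)
  also have "\<dots> = (\<Sum>xs\<in>paths_to (h, t). \<P>(S in P. begins_with S xs))"
  proof (rule finite_measure_finite_Union)
    show "disjoint_family_on (\<lambda>xs. {S \<in> space P. begins_with S xs}) (paths_to (h, t))"
      by (force simp: disjoint_family_on_def begins_with_def dest: length_paths_to)
  qed (use meas finite_paths_to in auto)
  finally show ?thesis .
qed

lemma prob_begins_with_non_path:
  assumes "prob_space P" and sets: "sets P = sets seq_space" and AE: "AE S in P. std_path S"
    and "xs \<noteq> []" "\<not> (hd xs = (0, 0) \<and> successively edge xs)"
  shows "\<P>(S in P. begins_with S xs) = 0"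
proof -
  interpret prob_space P by fact
  note [measurable_cong] = sets
  have "AE S in P. \<not> begins_with S xs"
    using AE by eventually_elim (use std_path_begins_with assms(4,5) in blast)
  then show ?thesis by (subst prob_Collect_eq_0) simp_all
qed

text \<open>Each nonempty list that is not a path from the origin has a null cylinder, and there are
  only countably many lists.\<close>

lemma cylinder_law_std_path:
  assumes P: "cylinder_law w1 w0 \<phi> P"
  shows "AE S in P. std_path S"
proof -
  interpret prob_space P using P by (simp add: cylinder_law_def)
  have [measurable_cong]: "sets P = sets seq_space"
    and cyl: "\<And>xs. xs \<noteq> [] \<Longrightarrow> \<P>(S in P. begins_with S xs) = cylinder_prob w1 w0 \<phi> xs"
    using P by (auto simp: cylinder_law_def)
  have "AE S in P. begins_with S xs \<longrightarrow> xs = [] \<or> (hd xs = (0, 0) \<and> successively edge xs)"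
    for xs :: "(nat \<times> nat) list"
  proof (cases "xs = [] \<or> (hd xs = (0, 0) \<and> successively edge xs)")
    case False
    then have "\<P>(S in P. begins_with S xs) = 0" using cyl[of xs] by (auto simp: cylinder_prob_def)
    then have "AE S in P. \<not> begins_with S xs" by (subst (asm) prob_Collect_eq_0) simp_all
    then show ?thesis by eventually_elim simp
  qed simp
  then have "AE S in P. \<forall>xs. begins_with S xs \<longrightarrow> xs = [] \<or> (hd xs = (0, 0) \<and> successively edge xs)"
    unfolding AE_all_countable by blast
  then show ?thesis
  proof eventually_elim
    case (elim S)
    have *: "hd (map S [0..<Suc (Suc n)]) = (0, 0)" "successively edge (map S [0..<Suc (Suc n)])" for n
      using elim[rule_format, of "map S [0..<Suc (Suc n)]"]
      by (simp_all add: begins_with_def del: upt_Suc)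
    have "S 0 = (0, 0)" using *(1)[of 0] by simp
    moreover have "edge (S n) (S (Suc n))" for n
      using *(2)[of n] by (auto simp: successively_conv_nth simp del: upt_Suc)
    ultimately show ?case by (simp add: std_path_def)
  qed
qed

lemma cylinder_prob_paths_to:
  "xs \<in> paths_to (h, t) \<Longrightarrow> cylinder_prob w1 w0 \<phi> xs = path_weight w1 w0 xs * \<phi> h t"
  by (auto simp: cylinder_prob_def paths_to_def)

section \<open>Correspondence between laws and harmonic functions\<close>

locale positive_weights =
  fixes w1 w0 :: "nat \<Rightarrow> nat \<Rightarrow> real"
  assumes w1_pos: "\<And>h t. w1 h t > 0" and w0_pos: "\<And>h t. w0 h t > 0"
begin

lemma path_weight_pos: "path_weight w1 w0 xs > 0"
  unfolding path_weight_def edge_weight_def by (intro prod_pos) (auto simp: w1_pos w0_pos)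

lemma d_pos: "d w1 w0 h t > 0"
  unfolding d_def by (intro sum_pos finite_paths_to paths_to_nonempty path_weight_pos)

text \<open>The factor on the left keeps the identity true at zeros of \<open>\<phi>\<close>: there
  \<open>\<phi>\<close> vanishes at both successors too.\<close>

lemma pmf_harmonic_step:
  assumes "harmonic w1 w0 \<phi>"
  shows "\<phi> (fst x) (snd x) * pmf (harmonic_step w1 \<phi> x) y =
    (if edge x y then edge_weight w1 w0 x y * \<phi> (fst y) (snd y) else 0)"
proof -
  obtain h t where x: "x = (h, t)" by (cases x)
  let ?g = "\<lambda>right. if right then (h + 1, t) else (h, t + 1)"
  have nn: "0 \<le> \<phi> h t" for h t
    using harmonicD[OF assms] by blast
  have rec: "\<phi> h t = w1 h t * \<phi> (Suc h) t + w0 h t * \<phi> h (Suc t)"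
    using harmonicD[OF assms] by blast+
  have r: "0 \<le> w1 h t * \<phi> (Suc h) t" and l: "0 \<le> w0 h t * \<phi> h (Suc t)"
    using nn w1_pos[of h t] w0_pos[of h t] by (simp_all add: less_imp_le)
  show ?thesis
  proof (cases "\<phi> h t = 0")
    case True
    then have "w1 h t * \<phi> (Suc h) t = 0" "w0 h t * \<phi> h (Suc t) = 0"
      using r l rec by linarith+
    then have "\<phi> (Suc h) t = 0" "\<phi> h (Suc t) = 0"
      using w1_pos[of h t] w0_pos[of h t] by simp_all
    then show ?thesis using True by (auto simp: x edge_def)
  next
    case False
    let ?p = "w1 h t * \<phi> (Suc h) t / \<phi> h t"
    have pos: "0 < \<phi> h t" using False nn[of h t] by simp
    have p: "0 \<le> ?p" "?p \<le> 1" using pos r l rec by simp_all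
    have inj: "inj ?g" by (auto simp: inj_def)
    have K: "harmonic_step w1 \<phi> x = map_pmf ?g (bernoulli_pmf ?p)"
      by (simp add: harmonic_step_def x)
    consider "y = ?g True" | "y = ?g False" | "y \<notin> range ?g" by (auto simp: image_iff)
    then show ?thesis
    proof cases
      case 1
      then show ?thesis
        using pmf_map_inj'[OF inj, of "bernoulli_pmf ?p" True] p pos
        unfolding K by (simp add: x edge_def edge_weight_def)
    next
      case 2
      have "\<phi> h t * (1 - ?p) = w0 h t * \<phi> h (Suc t)"
        using pos rec by (simp add: right_diff_distrib)
      then show ?thesis
        using pmf_map_inj'[OF inj, of "bernoulli_pmf ?p" False] p 2
        unfolding K by (simp add: x edge_def edge_weight_def)
    next
      case 3
      then have "y \<notin> set_pmf (harmonic_step w1 \<phi> x)" by (auto simp: K)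
      moreover have "\<not> edge x y"
      proof
        assume "edge x y"
        then have "y = ?g True \<or> y = ?g False" by (auto simp: edge_def x)
        then have "y \<in> range ?g" by (elim disjE) (erule range_eqI)+
        with 3 show False by contradiction
      qed
      ultimately show ?thesis by (simp add: set_pmf_iff)
    qed
  qed
qed

lemma cylinder_prob_snoc:
  assumes "harmonic w1 w0 \<phi>" "xs \<noteq> []"
  shows "cylinder_prob w1 w0 \<phi> (xs @ [y]) =
    cylinder_prob w1 w0 \<phi> xs * pmf (harmonic_step w1 \<phi> (last xs)) y"
  using assms(2) pmf_harmonic_step[OF assms(1), of "last xs" y]
  by (auto simp: cylinder_prob_def successively_append_iff path_weight_snoc mult.assoc
      split: if_splits)

lemma cylinder_prob_single:
  "harmonic w1 w0 \<phi> \<Longrightarrow> cylinder_prob w1 w0 \<phi> [x] = (if x = (0, 0) then 1 else 0)"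
  using harmonicD(2) by (auto simp: cylinder_prob_def)

text \<open>Both sides prescribe the same product for every prefix, one factor per step. Existence
  and uniqueness of the law for a given \<open>\<phi>\<close> are thus inherited from Markov
  chains.\<close>

lemma cylinder_law_iff_markov:
  assumes \<phi>: "harmonic w1 w0 \<phi>"
  shows "cylinder_law w1 w0 \<phi> P \<longleftrightarrow> is_markov_chain_law (0, 0) (harmonic_step w1 \<phi>) P"
proof
  assume P: "cylinder_law w1 w0 \<phi> P"
  then interpret prob_space P by (simp add: cylinder_law_def)
  have sets[measurable_cong]: "sets P = sets seq_space"
    and cyl: "\<And>xs. xs \<noteq> [] \<Longrightarrow> \<P>(S in P. begins_with S xs) = cylinder_prob w1 w0 \<phi> xs"
    using P by (auto simp: cylinder_law_def)
  have "\<P>(S in P. S 0 = (0, 0)) = 1"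
    using cyl[of "[(0, 0)]"] cylinder_prob_single[OF \<phi>] by (simp add: begins_with_iff)
  then have "AE S in P. S 0 = (0, 0)" by (subst (asm) prob_Collect_eq_1) simp_all
  moreover have "\<P>(S in P. S (length xs) = y \<bar> begins_with S xs) = pmf (harmonic_step w1 \<phi> (last xs)) y"
    if "xs \<noteq> []" "\<P>(S in P. begins_with S xs) > 0" for xs y
  proof -
    have "\<P>(S in P. S (length xs) = y \<and> begins_with S xs) = cylinder_prob w1 w0 \<phi> (xs @ [y])"
      using cyl[of "xs @ [y]"] by (simp add: begins_with_snoc)
    then show ?thesis
      using that cyl[of xs] by (simp add: cond_prob_def cylinder_prob_snoc[OF \<phi>])
  qed
  ultimately show "is_markov_chain_law (0, 0) (harmonic_step w1 \<phi>) P"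
    using sets prob_space_axioms by (simp add: is_markov_chain_law_def)
next
  assume P: "is_markov_chain_law (0, 0) (harmonic_step w1 \<phi>) P"
  let ?K = "harmonic_step w1 \<phi>"
  have "(if hd xs = (0, 0) then \<Prod>i<length xs - 1. pmf (?K (xs ! i)) (xs ! Suc i) else 0) =
      cylinder_prob w1 w0 \<phi> xs" if "xs \<noteq> []" for xs
    using that
  proof (induction xs rule: rev_nonempty_induct)
    case (single x)
    then show ?case by (simp add: cylinder_prob_single[OF \<phi>])
  next
    case (snoc y xs)
    obtain k where "length xs = Suc k" using snoc.hyps by (cases xs) auto
    then have "(\<Prod>i<length xs. pmf (?K ((xs @ [y]) ! i)) ((xs @ [y]) ! Suc i)) =
        (\<Prod>i<length xs - 1. pmf (?K (xs ! i)) (xs ! Suc i)) * pmf (?K (last xs)) y"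
      using snoc.hyps by (simp add: nth_append last_conv_nth)
    then show ?case
      using snoc by (simp add: cylinder_prob_snoc[OF \<phi>] split: if_splits flip: snoc.IH)
  qed
  then show "cylinder_law w1 w0 \<phi> P"
    using markov_chain_law_cylinder[OF P] P by (simp add: cylinder_law_def is_markov_chain_law_def)
qed

lemma cylinder_law_exists: "harmonic w1 w0 \<phi> \<Longrightarrow> \<exists>P. cylinder_law w1 w0 \<phi> P"
  using markov_chain_law_exists[of "(0, 0)" "harmonic_step w1 \<phi>"]
  by (simp add: cylinder_law_iff_markov)

lemma cylinder_law_unique:
  "harmonic w1 w0 \<phi> \<Longrightarrow> cylinder_law w1 w0 \<phi> P \<Longrightarrow> cylinder_law w1 w0 \<phi> Q \<Longrightarrow> P = Q"
  using markov_chain_law_unique by (auto simp: cylinder_law_iff_markov)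

text \<open>Summing over all paths to \<open>(h, t)\<close> gives the endpoint probability
  \<open>d * \<phi>\<close>; in the conditional probability \<open>\<phi> h t\<close>
  cancels.\<close>

lemma cylinder_law_imp_path_law:
  assumes P: "cylinder_law w1 w0 \<phi> P"
  shows "P \<in> path_laws w1 w0" "prob_fun w1 w0 P = \<phi>"
proof -
  interpret prob_space P using P by (simp add: cylinder_law_def)
  have sets: "sets P = sets seq_space"
    and cyl: "\<And>xs. xs \<noteq> [] \<Longrightarrow> \<P>(S in P. begins_with S xs) = cylinder_prob w1 w0 \<phi> xs"
    using P by (auto simp: cylinder_law_def)
  note AE = cylinder_law_std_path[OF P]
  have cyl': "\<P>(S in P. begins_with S xs) = path_weight w1 w0 xs * \<phi> h t"
    if "xs \<in> paths_to (h, t)" for xs h t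
    using cyl[of xs] cylinder_prob_paths_to[OF that] that by (auto simp: paths_to_def)
  have pt: "\<P>(S in P. S (h + t) = (h, t)) = d w1 w0 h t * \<phi> h t" for h t
    unfolding endpoint_prob[OF prob_space_axioms sets AE] d_def sum_distrib_right
    by (rule sum.cong) (simp_all add: cyl')
  show "prob_fun w1 w0 P = \<phi>"
    using d_pos by (intro ext) (simp add: prob_fun_def pt less_imp_neq[symmetric])
  have "\<P>(S in P. begins_with S xs \<bar> S (h + t) = (h, t)) = path_weight w1 w0 xs / d w1 w0 h t"
    if pos: "\<P>(S in P. S (h + t) = (h, t)) > 0" and xs: "xs \<in> paths_to (h, t)" for h t xs
  proof -
    have "begins_with S xs \<and> S (h + t) = (h, t) \<longleftrightarrow> begins_with S xs" for S
      using begins_with_paths_to_endpoint[OF xs] by blast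
    moreover have "\<phi> h t \<noteq> 0" using pos unfolding pt by auto
    ultimately show ?thesis unfolding cond_prob_def pt by (simp add: cyl'[OF xs])
  qed
  then show "P \<in> path_laws w1 w0"
    using prob_space_axioms sets AE by (simp add: path_laws_def)
qed

text \<open>If an endpoint has probability 0, so has each cylinder leading to it; otherwise the
  conditioning property gives the value. The recursion for \<open>prob_fun\<close> comes from
  splitting one cylinder by the next step.\<close>

lemma path_law_imp_cylinder_law:
  assumes P: "P \<in> path_laws w1 w0"
  shows "cylinder_law w1 w0 (prob_fun w1 w0 P) P" "harmonic w1 w0 (prob_fun w1 w0 P)"
proof -
  let ?\<phi> = "prob_fun w1 w0 P"
  interpret prob_space P using P by (simp add: path_laws_def)
  have sets[measurable_cong]: "sets P = sets seq_space" and AE: "AE S in P. std_path S"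
    and cond: "\<And>h t xs. \<P>(S in P. S (h + t) = (h, t)) > 0 \<Longrightarrow> xs \<in> paths_to (h, t) \<Longrightarrow>
      \<P>(S in P. begins_with S xs \<bar> S (h + t) = (h, t)) = path_weight w1 w0 xs / d w1 w0 h t"
    using P by (auto simp: path_laws_def)
  have good: "\<P>(S in P. begins_with S xs) = path_weight w1 w0 xs * ?\<phi> h t"
    if xs: "xs \<in> paths_to (h, t)" for xs h t
  proof (cases "\<P>(S in P. S (h + t) = (h, t)) = 0")
    case True
    have "\<P>(S in P. begins_with S xs) \<le> \<P>(S in P. S (h + t) = (h, t))"
      by (intro finite_measure_mono) (auto simp: begins_with_paths_to_endpoint[OF xs])
    then have "\<P>(S in P. begins_with S xs) = 0"
      using True measure_nonneg[of P "{S \<in> space P. begins_with S xs}"] by linarith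
    then show ?thesis using True by (simp add: prob_fun_def)
  next
    case False
    then have pos: "\<P>(S in P. S (h + t) = (h, t)) > 0" by (simp add: zero_less_measure_iff)
    have "begins_with S xs \<and> S (h + t) = (h, t) \<longleftrightarrow> begins_with S xs" for S
      using begins_with_paths_to_endpoint[OF xs] by blast
    then show ?thesis
      using cond[OF pos xs] False by (simp add: cond_prob_def prob_fun_def divide_eq_eq)
  qed
  show law: "cylinder_law w1 w0 ?\<phi> P"
    unfolding cylinder_law_def
  proof (intro conjI allI impI sets prob_space_axioms)
    fix xs :: "(nat \<times> nat) list" assume "xs \<noteq> []"
    show "\<P>(S in P. begins_with S xs) = cylinder_prob w1 w0 ?\<phi> xs"
    proof (cases "hd xs = (0, 0) \<and> successively edge xs")
      case True
      then have "xs \<in> paths_to (fst (last xs), snd (last xs))"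
        using \<open>xs \<noteq> []\<close> by (simp add: paths_to_def)
      from good[OF this] cylinder_prob_paths_to[OF this] show ?thesis by simp
    next
      case False
      then show ?thesis
        using prob_begins_with_non_path[OF prob_space_axioms sets AE \<open>xs \<noteq> []\<close>]
        by (auto simp: cylinder_prob_def)
    qed
  qed
  show "harmonic w1 w0 ?\<phi>"
    unfolding harmonic_def
  proof (intro conjI allI)
    show "0 \<le> ?\<phi> h t" for h t using d_pos[of h t] by (simp add: prob_fun_def)
    have "\<P>(S in P. begins_with S [(0, 0)]) = 1"
    proof (subst prob_Collect_eq_1)
      show "AE S in P. begins_with S [(0, 0)]"
        using AE by eventually_elim (simp add: std_path_def begins_with_iff)
    qed simp
    moreover have "[(0, 0)] \<in> paths_to (0, 0)" by (simp add: paths_to_def)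
    ultimately show "?\<phi> 0 0 = 1" using good[of "[(0, 0)]" 0 0] by simp
    show "?\<phi> h t = w1 h t * ?\<phi> (Suc h) t + w0 h t * ?\<phi> h (Suc t)" for h t
    proof -
      \<comment> \<open>Any path to \<open>(h, t)\<close> will do: its positive weight cancels at
        the end.\<close>
      obtain xs where xs: "xs \<in> paths_to (h, t)" using paths_to_nonempty by blast
      then have xs': "xs \<noteq> []" "last xs = (h, t)" "hd xs = (0, 0)" "successively edge xs"
        by (auto simp: paths_to_def)
      let ?r = "xs @ [(Suc h, t)]" and ?u = "xs @ [(h, Suc t)]"
      have r: "?r \<in> paths_to (Suc h, t)" and u: "?u \<in> paths_to (h, Suc t)"
        using xs' by (auto simp: paths_to_def successively_append_iff edge_def)
      have "\<P>(S in P. begins_with S xs) = \<P>(S in P. begins_with S ?r \<or> begins_with S ?u)"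
      proof (rule prob_eq_AE)
        show "AE S in P. begins_with S xs \<longleftrightarrow> begins_with S ?r \<or> begins_with S ?u"
          using AE
        proof eventually_elim
          case (elim S)
          show ?case
          proof (cases "begins_with S xs")
            case True
            have "S (h + t) = (h, t)" using begins_with_paths_to_endpoint[OF xs True] .
            moreover have "edge (S (h + t)) (S (Suc (h + t)))" using elim by (simp add: std_path_def)
            ultimately show ?thesis
              using True length_paths_to[OF xs] by (auto simp: begins_with_snoc edge_def)
          qed (simp add: begins_with_snoc)
        qed
      qed simp_all
      also have "\<dots> = prob ({S \<in> space P. begins_with S ?r} \<union> {S \<in> space P. begins_with S ?u})"
        by (rule arg_cong[where f = prob]) auto
      also have "\<dots> = \<P>(S in P. begins_with S ?r) + \<P>(S in P. begins_with S ?u)"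
        by (rule finite_measure_Union) (auto simp: begins_with_snoc)
      finally have "path_weight w1 w0 xs * ?\<phi> h t =
          path_weight w1 w0 xs * (w1 h t * ?\<phi> (Suc h) t + w0 h t * ?\<phi> h (Suc t))"
        unfolding good[OF xs] good[OF r] good[OF u] path_weight_snoc[OF xs'(1)] xs'(2)
        by (simp add: edge_weight_def algebra_simps)
      then show ?thesis using path_weight_pos[of xs] by simp
    qed
  qed
qed

lemma path_laws_eqI:
  assumes "P \<in> path_laws w1 w0" "Q \<in> path_laws w1 w0" "prob_fun w1 w0 P = prob_fun w1 w0 Q"
  shows "P = Q"
  using cylinder_law_unique path_law_imp_cylinder_law assms by metis

section \<open>Mixtures and extreme points\<close>

text \<open>Choosing \<open>P1\<close> or \<open>P2\<close> by a biased coin gives a law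
  \<open>M\<close>. As \<open>cylinder_prob\<close> is linear in \<open>\<phi>\<close>,
  \<open>M\<close> has the cylinder probabilities of \<open>P\<close>, and uniqueness extends the
  pointwise identity to all measurable sets.\<close>

lemma measure_mixture:
  assumes \<phi>1: "harmonic w1 w0 \<phi>1" and \<phi>2: "harmonic w1 w0 \<phi>2" and u: "0 < u" "u < 1"
    and \<phi>: "harmonic w1 w0 \<phi>" "\<And>h t. \<phi> h t = (1 - u) * \<phi>1 h t + u * \<phi>2 h t"
    and P: "cylinder_law w1 w0 \<phi> P" "cylinder_law w1 w0 \<phi>1 P1" "cylinder_law w1 w0 \<phi>2 P2"
    and A: "A \<in> sets P"
  shows "measure P A = (1 - u) * measure P1 A + u * measure P2 A"
proof -
  define f where "f b = (if b then P2 else P1)" for b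
  define M where "M = measure_pmf (bernoulli_pmf u) \<bind> f"
  have f: "prob_space (f b)" "sets (f b) = sets seq_space" for b
    using P by (auto simp: f_def cylinder_law_def)
  have meas: "f \<in> measure_pmf (bernoulli_pmf u) \<rightarrow>\<^sub>M subprob_algebra seq_space"
    using f by (auto simp: space_subprob_algebra prob_space_imp_subprob_space)
  have sets: "sets M = sets seq_space"
    unfolding M_def by (rule sets_bind) (simp_all add: f)
  have M: "measure M X = (1 - u) * measure P1 X + u * measure P2 X" if "X \<in> sets seq_space" for X
    unfolding M_def
    by (subst subprob_space.measure_bind[OF _ meas that])
      (use u in \<open>simp_all add: f_def measure_pmf.subprob_space_axioms\<close>)
  have spaces: "space M = UNIV" "space P1 = UNIV" "space P2 = UNIV"
    using sets P by (auto simp: cylinder_law_def dest: sets_eq_imp_space_eq)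
  have "cylinder_law w1 w0 \<phi> M"
    unfolding cylinder_law_def
  proof (intro conjI allI impI sets)
    show "prob_space M"
      unfolding M_def
      by (rule prob_space.prob_space_bind[OF measure_pmf.prob_space_axioms _ meas]) (simp add: f)
    fix xs :: "(nat \<times> nat) list" assume xs: "xs \<noteq> []"
    have "\<P>(S in M. begins_with S xs) =
        (1 - u) * \<P>(S in P1. begins_with S xs) + u * \<P>(S in P2. begins_with S xs)"
      using M[of "{S. begins_with S xs}"] measurable_begins_with[of xs]
      by (simp add: spaces pred_def)
    also have "\<dots> = (1 - u) * cylinder_prob w1 w0 \<phi>1 xs + u * cylinder_prob w1 w0 \<phi>2 xs"
      using P(2,3) xs by (simp add: cylinder_law_def)
    also have "\<dots> = cylinder_prob w1 w0 \<phi> xs"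
      by (simp add: cylinder_prob_def \<phi>(2) algebra_simps)
    finally show "\<P>(S in M. begins_with S xs) = cylinder_prob w1 w0 \<phi> xs" .
  qed
  then have "M = P" using cylinder_law_unique[OF \<phi>(1)] P(1) by blast
  then show ?thesis using M[of A] A sets by simp
qed

text \<open>A decomposition of \<open>prob_fun\<close> lifts to the laws by
  \<open>measure_mixture\<close>; a decomposition of the law passes to \<open>prob_fun\<close>
  through the events \<open>S (h + t) = (h, t)\<close>.\<close>

theorem extreme_measures_iff:
  "P \<in> extreme_measures (path_laws w1 w0) \<longleftrightarrow>
    P \<in> path_laws w1 w0 \<and> extreme_harmonic w1 w0 (prob_fun w1 w0 P)"
    (is "?l \<longleftrightarrow> ?r")
proof
  assume ex: ?l
  then have P: "P \<in> path_laws w1 w0" by (simp add: extreme_measures_def)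
  note \<phi> = path_law_imp_cylinder_law[OF P]
  have "\<phi>1 = \<phi>2"
    if h: "harmonic w1 w0 \<phi>1" "harmonic w1 w0 \<phi>2" and u: "0 < u" "u < 1"
      and eq: "\<forall>h t. prob_fun w1 w0 P h t = (1 - u) * \<phi>1 h t + u * \<phi>2 h t" for \<phi>1 \<phi>2 u
  proof -
    obtain P1 P2 where c: "cylinder_law w1 w0 \<phi>1 P1" "cylinder_law w1 w0 \<phi>2 P2"
      using cylinder_law_exists h by blast
    note p1 = cylinder_law_imp_path_law[OF c(1)] and p2 = cylinder_law_imp_path_law[OF c(2)]
    have "\<forall>A\<in>sets P. measure P A = (1 - u) * measure P1 A + u * measure P2 A"
      using measure_mixture[OF h u \<phi>(2) _ \<phi>(1) c] eq by blast
    then have "P1 = P2" using ex p1(1) p2(1) u unfolding extreme_measures_def by blast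
    then show ?thesis using p1(2) p2(2) by simp
  qed
  then show ?r using P \<phi>(2) by (simp add: extreme_harmonic_def)
next
  assume r: ?r
  then have P: "P \<in> path_laws w1 w0" by simp
  have "P1 = P2"
    if p: "P1 \<in> path_laws w1 w0" "P2 \<in> path_laws w1 w0" and u: "0 < u" "u < 1"
      and eq: "\<forall>A\<in>sets P. measure P A = (1 - u) * measure P1 A + u * measure P2 A" for P1 P2 u
  proof -
    have sets: "sets P = sets seq_space" "sets P1 = sets seq_space" "sets P2 = sets seq_space"
      using P p by (auto simp: path_laws_def)
    then have spaces: "space P = UNIV" "space P1 = UNIV" "space P2 = UNIV"
      by (auto dest: sets_eq_imp_space_eq)
    have "prob_fun w1 w0 P h t = (1 - u) * prob_fun w1 w0 P1 h t + u * prob_fun w1 w0 P2 h t" for h t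
    proof -
      have "{S. S (h + t) = (h, t)} \<in> sets P"
        using measurable_sets[OF measurable_seq_space_nth[of "h + t"], of "{(h, t)}"]
        by (simp add: sets vimage_def)
      then show ?thesis using eq by (simp add: prob_fun_def spaces add_divide_distrib)
    qed
    then have "prob_fun w1 w0 P1 = prob_fun w1 w0 P2"
      using r path_law_imp_cylinder_law(2)[OF p(1)] path_law_imp_cylinder_law(2)[OF p(2)] u
      unfolding extreme_harmonic_def by blast
    then show ?thesis using path_laws_eqI p by blast
  qed
  then show ?l using P unfolding extreme_measures_def by blast
qed

end


subsection \<open>Eulerian weights\<close>

abbreviation euler_harmonic :: "real \<Rightarrow> real \<Rightarrow> (nat \<Rightarrow> nat \<Rightarrow> real) \<Rightarrow> bool" where
  "euler_harmonic a b \<equiv> harmonic (euler_w1 a) (euler_w0 b)"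

lemma euler_harmonicD:
  assumes "euler_harmonic a b \<phi>"
  shows "0 \<le> \<phi> h t" "\<phi> 0 0 = 1"
    "\<phi> h t = (real t + a) * \<phi> (Suc h) t + (real h + b) * \<phi> h (Suc t)"
  using assms unfolding harmonic_def euler_w1_def euler_w0_def by blast+

lemma euler_harmonicI:
  assumes "\<And>h t. 0 \<le> \<phi> h t" "\<phi> 0 0 = 1"
    "\<And>h t. \<phi> h t = (real t + a) * \<phi> (Suc h) t + (real h + b) * \<phi> h (Suc t)"
  shows "euler_harmonic a b \<phi>"
  using assms unfolding harmonic_def euler_w1_def euler_w0_def by blast

text \<open>Reflection in the diagonal, which turns results on columns into results on rows.\<close>

lemma euler_harmonic_swap:
  assumes "euler_harmonic a b \<phi>"
  shows "euler_harmonic b a (\<lambda>h t. \<phi> t h)"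
proof (rule euler_harmonicI)
  fix h t
  show "\<phi> t h = (real t + b) * \<phi> t (Suc h) + (real h + a) * \<phi> (Suc t) h"
    using euler_harmonicD(3)[OF assms, of t h] by (simp only: add.commute)
qed (use euler_harmonicD(1,2)[OF assms] in auto)

lemma extreme_euler_harmonic_swap:
  assumes "extreme_harmonic (euler_w1 a) (euler_w0 b) \<phi>"
  shows "extreme_harmonic (euler_w1 b) (euler_w0 a) (\<lambda>h t. \<phi> t h)"
proof -
  have "\<phi>1 = \<phi>2"
    if "euler_harmonic b a \<phi>1" "euler_harmonic b a \<phi>2" "0 < u" "u < 1"
      "\<forall>h t. \<phi> t h = (1 - u) * \<phi>1 h t + u * \<phi>2 h t" for \<phi>1 \<phi>2 u
  proof -
    have "(\<lambda>h t. \<phi>1 t h) = (\<lambda>h t. \<phi>2 t h)"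
      using assms euler_harmonic_swap[OF that(1)] euler_harmonic_swap[OF that(2)] that(3-5)
      unfolding extreme_harmonic_def by blast
    then show ?thesis by (metis ext)
  qed
  then show ?thesis
    using assms euler_harmonic_swap unfolding extreme_harmonic_def by blast
qed


subsection \<open>Behaviour along a column\<close>

lemma column_step:
  assumes "a > 0" "euler_harmonic a b \<phi>"
  shows "(real h + b) * \<phi> h (Suc t) \<le> \<phi> h t"
  using euler_harmonicD(1)[OF assms(2), of "Suc h" t] euler_harmonicD(3)[OF assms(2), of h t] assms(1)
  by simp

text \<open>The probability of following a given path to \<open>(h, t)\<close> and then going up
  forever is its weight times \<open>L / (h + b)^t\<close>; so \<open>L = 0\<close> means that
  almost no path stays in column \<open>h\<close> forever.\<close>

lemma column_limit:
  assumes "a > 0" "b > 0" "euler_harmonic a b \<phi>"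
  obtains L where "0 \<le> L" "(\<lambda>t. \<phi> h t * (real h + b) ^ t) \<longlonglongrightarrow> L"
    "\<And>t. L \<le> \<phi> h t * (real h + b) ^ t"
proof -
  have "decseq (\<lambda>t. \<phi> h t * (real h + b) ^ t)"
    using column_step[OF assms(1,3), of h] assms(2)
    by (intro decseq_SucI) (simp add: mult.commute mult.left_commute)
  moreover have nn: "0 \<le> \<phi> h t * (real h + b) ^ t" for t
    using euler_harmonicD(1)[OF assms(3)] assms(2) by simp
  ultimately obtain L where "(\<lambda>t. \<phi> h t * (real h + b) ^ t) \<longlonglongrightarrow> L"
    "\<forall>t. L \<le> \<phi> h t * (real h + b) ^ t"
    using decseq_convergent by blast
  moreover from this(1) have "0 \<le> L" by (rule LIMSEQ_le_const) (use nn in blast)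
  ultimately show ?thesis using that by blast
qed

text \<open>The limit \<open>L\<close> exists by monotonicity, and passing to the limit in the ratio
  gives \<open>r * L = L\<close>.\<close>

lemma column_decay:
  assumes "a > 0" "b > 0" "euler_harmonic a b \<phi>"
    and q: "\<And>t. (real h + b) * \<phi> h (Suc t) = q t * \<phi> h t" "q \<longlonglongrightarrow> r" "r < 1"
  shows "(\<lambda>t. \<phi> h t * (real h + b) ^ t) \<longlonglongrightarrow> 0"
proof -
  let ?z = "\<lambda>t. \<phi> h t * (real h + b) ^ t"
  obtain L where L: "?z \<longlonglongrightarrow> L"
    using column_limit[OF assms(1-3), of h] by metis
  have "?z (Suc t) = q t * ?z t" for t
    using q(1)[of t] by (simp add: mult.assoc[symmetric] mult.commute)
  then have "(\<lambda>t. q t * ?z t) \<longlonglongrightarrow> L"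
    using LIMSEQ_Suc[OF L] by presburger
  moreover have "(\<lambda>t. q t * ?z t) \<longlonglongrightarrow> r * L"
    by (intro tendsto_mult q(2) L)
  ultimately have "r * L = L" using LIMSEQ_unique by blast
  then have "L = 0" using q(3) by auto
  then show ?thesis using L by simp
qed

text \<open>Minimum principle, going leftwards from column \<open>m\<close>. Once column
  \<open>h + 1\<close> is nonnegative, \<open>\<psi> h t * (h + b)^t\<close> decreases in
  \<open>t\<close>, and the bound by \<open>Q\<close> keeps its limit from being negative.\<close>

lemma superharmonic_nonneg:
  fixes \<psi> Q :: "nat \<Rightarrow> nat \<Rightarrow> real"
  assumes "a > 0" "b > 0"
    and super: "\<And>h t. (real t + a) * \<psi> (Suc h) t + (real h + b) * \<psi> h (Suc t) \<le> \<psi> h t"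
    and right: "\<And>h t. m \<le> h \<Longrightarrow> 0 \<le> \<psi> h t"
    and lower: "\<And>h t. - C * Q h t \<le> \<psi> h t"
    and decay: "\<And>h. h < m \<Longrightarrow> (\<lambda>t. Q h t * (real h + b) ^ t) \<longlonglongrightarrow> 0"
  shows "0 \<le> \<psi> h t"
proof (induction "m - h" arbitrary: h t)
  case 0
  then show ?case using right by simp
next
  case (Suc k)
  let ?y = "\<lambda>t. \<psi> h t * (real h + b) ^ t"
  have "h < m" "0 \<le> \<psi> (Suc h) s" for s using Suc.hyps by auto
  have "(real h + b) * \<psi> h (Suc s) \<le> \<psi> h s" for s
    using super[of s h] mult_nonneg_nonneg[OF _ \<open>0 \<le> \<psi> (Suc h) s\<close>, of "real s + a"] \<open>a > 0\<close> by linarith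
  then have dec: "decseq ?y"
    using \<open>b > 0\<close>
    by (intro decseq_SucI) (simp add: mult.commute mult.left_commute)
  have "(\<lambda>s. - C * (Q h s * (real h + b) ^ s)) \<longlonglongrightarrow> - C * 0"
    by (intro tendsto_mult tendsto_const decay \<open>h < m\<close>)
  then have "(\<lambda>s. - C * (Q h s * (real h + b) ^ s)) \<longlonglongrightarrow> 0" by simp
  moreover have "- C * (Q h s * (real h + b) ^ s) \<le> ?y t" if "t \<le> s" for s
  proof -
    have "- C * Q h s * (real h + b) ^ s \<le> ?y s"
      using lower[of h s] \<open>b > 0\<close> by (intro mult_right_mono) auto
    then show ?thesis using decseqD[OF dec that] by (simp add: mult.assoc)
  qed
  then have "\<exists>N. \<forall>s\<ge>N. - C * (Q h s * (real h + b) ^ s) \<le> ?y t" by blast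
  ultimately have "0 \<le> ?y t" by (rule LIMSEQ_le_const2)
  moreover have "0 < (real h + b) ^ t" using \<open>b > 0\<close> by simp
  ultimately show ?case by (simp add: zero_le_mult_iff)
qed


subsection \<open>The explicit harmonic functions\<close>

definition column_fun :: "real \<Rightarrow> real \<Rightarrow> nat \<Rightarrow> nat \<Rightarrow> nat \<Rightarrow> real" where
  "column_fun a b m h t = (if h \<le> m then
     fact m / fact (m - h) * pochhammer (a + b) (m + t) /
     (pochhammer (a + b) (h + t) * pochhammer (a + b) m * (real m + b) ^ (h + t)) else 0)"

definition star_fun :: "real \<Rightarrow> real \<Rightarrow> nat \<Rightarrow> nat \<Rightarrow> real" where
  "star_fun a b h t = 1 / pochhammer (a + b) (h + t)"

context
  fixes a b :: real
  assumes ab: "a > 0" "b > 0"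
begin

lemma pochhammer_ab_pos: "pochhammer (a + b) n > 0"
  using ab by (intro pochhammer_pos) simp

lemma column_fun_pos: "h \<le> m \<Longrightarrow> column_fun a b m h t > 0"
  using ab pochhammer_ab_pos unfolding column_fun_def by simp

lemma column_fun_up:
  "column_fun a b m h (Suc t) =
    (a + b + real m + real t) / ((a + b + real h + real t) * (real m + b)) * column_fun a b m h t"
  by (simp add: column_fun_def pochhammer_Suc add_ac mult_ac)

text \<open>The difference \<open>m - h\<close> is real, so the formula also covers
  \<open>h = m\<close>, where the factor vanishes, and \<open>h > m\<close>, where both sides are
  0.\<close>

lemma column_fun_right:
  "column_fun a b m (Suc h) t =
    (real m - real h) / ((a + b + real h + real t) * (real m + b)) * column_fun a b m h t"
proof (cases "h < m")
  case True
  then obtain k where k: "m - Suc h = k" "m - h = Suc k" "real m - real h = real (Suc k)"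
    by (metis Suc_diff_Suc less_imp_le of_nat_diff)
  show ?thesis
    using True unfolding k
    by (simp add: column_fun_def pochhammer_Suc k add_ac mult_ac del: of_nat_Suc)
qed (auto simp: column_fun_def)

lemma column_fun_origin: "column_fun a b m 0 0 = 1"
  using pochhammer_ab_pos[of m] by (simp add: column_fun_def)

lemma harmonic_column_fun: "euler_harmonic a b (column_fun a b m)"
proof (rule euler_harmonicI)
  fix h t
  show "0 \<le> column_fun a b m h t"
    using column_fun_pos[of h m t] by (cases "h \<le> m") (auto simp: column_fun_def)
  \<comment> \<open>This is the recursion once both successors are expressed by
    \<open>column_fun a b m h t\<close>.\<close>
  have *: "(real t + a) * (real m - real h) + (real h + b) * (a + b + real m + real t) =
      (a + b + real h + real t) * (real m + b)"
    by (simp add: algebra_simps)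
  have "(a + b + real h + real t) * (real m + b) \<noteq> 0" using ab by auto
  then show "column_fun a b m h t = (real t + a) * column_fun a b m (Suc h) t +
      (real h + b) * column_fun a b m h (Suc t)"
    unfolding column_fun_up column_fun_right mult.assoc[symmetric] distrib_right[symmetric]
      times_divide_eq_right add_divide_distrib[symmetric] * by simp
qed (rule column_fun_origin)

text \<open>On the last column of the support the recursion has no term to the right. The constant
  positive value serves as boundary value in comparisons.\<close>

lemma column_fun_top: "column_fun a b m m t * (real m + b) ^ t = column_fun a b m m 0"
  using ab pochhammer_ab_pos[of "m + t"] pochhammer_ab_pos[of m]
  by (simp add: column_fun_def power_add)

text \<open>Successive normalised values have ratios tending to
  \<open>(h + b) / (m + b) < 1\<close>.\<close>

lemma column_fun_decay:
  assumes "h < m"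
  shows "(\<lambda>t. column_fun a b m h t * (real h + b) ^ t) \<longlonglongrightarrow> 0"
proof (rule column_decay[OF ab harmonic_column_fun])
  show "(real h + b) * column_fun a b m h (Suc t) =
    (real h + b) * (a + b + real m + real t) / ((a + b + real h + real t) * (real m + b)) *
    column_fun a b m h t" for t
    by (simp add: column_fun_up)
  show "(\<lambda>t. (real h + b) * (a + b + real m + real t) /
      ((a + b + real h + real t) * (real m + b))) \<longlonglongrightarrow> (real h + b) / (real m + b)"
  proof -
    have "(\<lambda>t. 1 + (real m - real h) / (a + b + real h + real t)) \<longlonglongrightarrow> 1 + 0"
      by (intro tendsto_add tendsto_const real_tendsto_divide_at_top[OF tendsto_const]
          filterlim_real_sequentially filterlim_tendsto_add_at_top[OF tendsto_const])
    moreover have "1 + (real m - real h) / (a + b + real h + real t) =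
        (a + b + real m + real t) / (a + b + real h + real t)" for t
    proof -
      have "a + b + real h + real t \<noteq> 0" using ab by simp
      then show ?thesis by (simp add: add_divide_eq_iff)
    qed
    ultimately have ratio: "(\<lambda>t. (a + b + real m + real t) / (a + b + real h + real t)) \<longlonglongrightarrow> 1"
      by simp
    have "(\<lambda>t. (real h + b) * ((a + b + real m + real t) / (a + b + real h + real t)) / (real m + b))
        \<longlonglongrightarrow> (real h + b) * 1 / (real m + b)"
      using ab by (intro tendsto_intros ratio) simp
    then show ?thesis by simp
  qed
  show "(real h + b) / (real m + b) < 1" using ab assms by simp
qed

lemma star_fun_pos: "star_fun a b h t > 0"
  using pochhammer_ab_pos by (simp add: star_fun_def)

lemma harmonic_star_fun: "euler_harmonic a b (star_fun a b)"
proof (rule euler_harmonicI)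
  fix h t
  show "0 \<le> star_fun a b h t" using star_fun_pos[of h t] by simp
  define y where "y = (real t + a) + (real h + b)"
  have "star_fun a b (Suc h) t = star_fun a b h t / y" "star_fun a b h (Suc t) = star_fun a b h t / y"
    by (simp_all add: star_fun_def pochhammer_Suc y_def add_ac)
  moreover have "y \<noteq> 0" using ab by (auto simp: y_def)
  moreover have "(real t + a) * (s / y) + (real h + b) * (s / y) = y * (s / y)" for s
    unfolding y_def by (rule distrib_right[symmetric])
  ultimately show "star_fun a b h t = (real t + a) * star_fun a b (Suc h) t +
      (real h + b) * star_fun a b h (Suc t)"
    by simp
qed (simp add: star_fun_def)

lemma star_fun_decay: "(\<lambda>t. star_fun a b h t * (real h + b) ^ t) \<longlonglongrightarrow> 0"
proof (rule column_decay[OF ab harmonic_star_fun])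
  show "(real h + b) * star_fun a b h (Suc t) =
      (real h + b) / (a + b + real h + real t) * star_fun a b h t" for t
    by (simp add: star_fun_def pochhammer_Suc add_ac)
  show "(\<lambda>t. (real h + b) / (a + b + real h + real t)) \<longlonglongrightarrow> 0"
    by (intro real_tendsto_divide_at_top[OF tendsto_const] filterlim_real_sequentially
        filterlim_tendsto_add_at_top[OF tendsto_const])
qed simp

text \<open>Minimum principle for the difference: it is nonnegative on column \<open>m\<close> by
  the choice of the factor, equals \<open>\<phi>\<close> further right, and is bounded below by a
  multiple of \<open>column_fun\<close>, which decays further left.\<close>

lemma column_fun_le:
  assumes \<phi>: "euler_harmonic a b \<phi>"
    and L: "\<And>t. L \<le> \<phi> m t * (real m + b) ^ t"
  shows "L / column_fun a b m m 0 * column_fun a b m h t \<le> \<phi> h t"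
proof -
  \<comment> \<open>Makes \<open>C * column_fun a b m m t * (m + b)^t\<close> equal to
    \<open>L\<close> for every \<open>t\<close>.\<close>
  define C where "C = L / column_fun a b m m 0"
  let ?\<psi> = "\<lambda>h t. \<phi> h t - C * column_fun a b m h t"
  have top: "column_fun a b m m 0 > 0" using column_fun_pos[of m m 0] by simp
  have "0 \<le> ?\<psi> h t"
  proof (rule superharmonic_nonneg[OF ab, where m = m and Q = "column_fun a b m" and C = C])
    fix h t
    show "(real t + a) * ?\<psi> (Suc h) t + (real h + b) * ?\<psi> h (Suc t) \<le> ?\<psi> h t"
    proof -
      have "p * (x - C * x') + q * (y - C * y') = p * x + q * y - C * (p * x' + q * y')"
        for p q x x' y y' :: real
        by (simp add: algebra_simps)
      then show ?thesis
        using euler_harmonicD(3)[OF \<phi>, of h t]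
          euler_harmonicD(3)[OF harmonic_column_fun, of m h t] by simp
    qed
    show "- C * column_fun a b m h t \<le> ?\<psi> h t"
      using euler_harmonicD(1)[OF \<phi>, of h t] by simp
    show "0 \<le> ?\<psi> h t" if "m \<le> h"
    proof (cases "h = m")
      case True
      have "C * (column_fun a b m m t * (real m + b) ^ t) = L"
        using top unfolding column_fun_top by (simp add: C_def)
      then have "C * column_fun a b m m t * (real m + b) ^ t \<le> \<phi> m t * (real m + b) ^ t"
        using L[of t] by (simp add: mult.assoc)
      then show ?thesis
        using ab by (simp add: True mult_le_cancel_right)
    next
      case False
      then show ?thesis using that euler_harmonicD(1)[OF \<phi>] by (simp add: column_fun_def)
    qed
  qed (rule column_fun_decay)
  then show ?thesis by (simp add: C_def)
qed

end


subsection \<open>The harmonic function without mass on rows and columns\<close>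

text \<open>The total weight of the paths from the origin to \<open>(h, t)\<close>, where the weights of the two edges
  leaving the origin are replaced by \<open>p\<close> (right) and \<open>q\<close> (up). The value at the origin is junk.\<close>

fun path_mass :: "real \<Rightarrow> real \<Rightarrow> real \<Rightarrow> real \<Rightarrow> nat \<Rightarrow> nat \<Rightarrow> real" where
  "path_mass a b p q 0 0 = 0"
| "path_mass a b p q (Suc 0) 0 = p"
| "path_mass a b p q 0 (Suc 0) = q"
| "path_mass a b p q (Suc (Suc h)) 0 = a * path_mass a b p q (Suc h) 0"
| "path_mass a b p q 0 (Suc (Suc t)) = b * path_mass a b p q 0 (Suc t)"
| "path_mass a b p q (Suc h) (Suc t) =
     (real (Suc t) + a) * path_mass a b p q h (Suc t) + (real (Suc h) + b) * path_mass a b p q (Suc h) t"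

lemma path_mass_nonneg:
  "a > 0 \<Longrightarrow> b > 0 \<Longrightarrow> p \<ge> 0 \<Longrightarrow> q \<ge> 0 \<Longrightarrow> path_mass a b p q h t \<ge> 0"
  by (induction a b p q h t rule: path_mass.induct) auto

lemma path_mass_pos:
  "a > 0 \<Longrightarrow> b > 0 \<Longrightarrow> p > 0 \<Longrightarrow> q > 0 \<Longrightarrow> h + t > 0 \<Longrightarrow> path_mass a b p q h t > 0"
  by (induction a b p q h t rule: path_mass.induct) (auto simp del: of_nat_Suc intro!: add_pos_pos mult_pos_pos)

text \<open>The case splits mark missing predecessors, since truncated subtraction would not leave
  the point. Points with \<open>h + t = 1\<close> carry the prescribed values \<open>p\<close> and
  \<open>q\<close>.\<close>

lemma path_mass_rec:
  assumes "h + t \<ge> 2"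
  shows "path_mass a b p q h t =
    (if h = 0 then 0 else (real t + a) * path_mass a b p q (h - 1) t) +
    (if t = 0 then 0 else (real h + b) * path_mass a b p q h (t - 1))"
  using assms by (cases "(a, b, p, q, h, t)" rule: path_mass.cases) auto

text \<open>The forward recursion of \<open>path_mass\<close> is adjoint to the backward recursion
  of \<open>\<phi>\<close>, so the sum over a diagonal keeps the value it has for
  \<open>n = 1\<close>.\<close>

lemma path_mass_pairing:
  assumes "euler_harmonic a b \<phi>" "n \<ge> 1"
  shows "(\<Sum>h\<le>n. path_mass a b p q h (n - h) * \<phi> h (n - h)) = p * \<phi> 1 0 + q * \<phi> 0 1"
  using \<open>n \<ge> 1\<close>
proof (induction n rule: dec_induct)
  case base
  then show ?case by (simp add: atMost_Suc)
next
  case (step n)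
  let ?v = "path_mass a b p q"
  \<comment> \<open>\<open>A\<close> and \<open>B\<close> are the contributions to
    \<open>(h, n + 1 - h)\<close> from its left and its lower neighbour on diagonal
    \<open>n\<close>; each is 0 at the end where that neighbour is missing.\<close>
  define A where "A h = (if h = 0 then 0 else (real (Suc n - h) + a) * ?v (h - 1) (Suc n - h))" for h
  define B where "B h = (if h = Suc n then 0 else (real h + b) * ?v h (n - h))" for h
  have AB: "?v h (Suc n - h) = A h + B h" if "h \<le> Suc n" for h
    using path_mass_rec[of h "Suc n - h" a b p q] that step.hyps
    by (auto simp: A_def B_def Suc_diff_le)
  have "(\<Sum>h\<le>Suc n. ?v h (Suc n - h) * \<phi> h (Suc n - h)) =
      (\<Sum>h\<le>Suc n. A h * \<phi> h (Suc n - h)) + (\<Sum>h\<le>Suc n. B h * \<phi> h (Suc n - h))"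
    by (simp add: AB distrib_right sum.distrib del: sum.atMost_Suc)
  also have "(\<Sum>h\<le>Suc n. A h * \<phi> h (Suc n - h)) =
      (\<Sum>h\<le>n. ?v h (n - h) * ((real (n - h) + a) * \<phi> (Suc h) (n - h)))"
    by (subst sum.atMost_Suc_shift) (simp add: A_def mult_ac)
  also have "(\<Sum>h\<le>Suc n. B h * \<phi> h (Suc n - h)) =
      (\<Sum>h\<le>n. ?v h (n - h) * ((real h + b) * \<phi> h (Suc (n - h))))"
    by (simp add: B_def mult_ac Suc_diff_le)
  also have "(\<Sum>h\<le>n. ?v h (n - h) * ((real (n - h) + a) * \<phi> (Suc h) (n - h))) +
      (\<Sum>h\<le>n. ?v h (n - h) * ((real h + b) * \<phi> h (Suc (n - h)))) =
      (\<Sum>h\<le>n. ?v h (n - h) * \<phi> h (n - h))"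
    unfolding sum.distrib[symmetric] distrib_left[symmetric]
    by (simp only: euler_harmonicD(3)[OF assms(1), symmetric])
  finally show ?case using step.IH by simp
qed

section \<open>Monotonicity of the first-step probability along diagonals\<close>

lemma mediant_between:
  fixes x y X Y \<alpha> \<beta> :: real
  assumes "X > 0" "Y > 0" "\<alpha> > 0" "\<beta> > 0" "x / X \<le> y / Y"
  shows "x / X \<le> (\<alpha> * x + \<beta> * y) / (\<alpha> * X + \<beta> * Y)"
    and "(\<alpha> * x + \<beta> * y) / (\<alpha> * X + \<beta> * Y) \<le> y / Y"
proof -
  have *: "x * Y \<le> y * X" using assms by (simp add: field_simps)
  have pos: "\<alpha> * X + \<beta> * Y > 0" using assms by (simp add: add_pos_pos)
  have "x * (\<alpha> * X + \<beta> * Y) \<le> (\<alpha> * x + \<beta> * y) * X"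
    using mult_left_mono[OF *, of \<beta>] assms(4) by (simp add: algebra_simps)
  then show "x / X \<le> (\<alpha> * x + \<beta> * y) / (\<alpha> * X + \<beta> * Y)"
    using assms(1) pos by (simp add: divide_le_eq pos_le_divide_eq mult.commute)
  have "(\<alpha> * x + \<beta> * y) * Y \<le> y * (\<alpha> * X + \<beta> * Y)"
    using mult_left_mono[OF *, of \<alpha>] assms(3) by (simp add: algebra_simps)
  then show "(\<alpha> * x + \<beta> * y) / (\<alpha> * X + \<beta> * Y) \<le> y / Y"
    using assms(2) pos by (simp add: divide_le_eq pos_le_divide_eq mult.commute)
qed

text \<open>\<open>a * right_start a b h t\<close> is the conditional probability of a first step to the right, given
  that the path passes through \<open>(h, t)\<close>.\<close>

definition right_start :: "real \<Rightarrow> real \<Rightarrow> nat \<Rightarrow> nat \<Rightarrow> real" where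
  "right_start a b h t = path_mass a b 1 0 h t / path_mass a b a b h t"

text \<open>Both points are compared with \<open>(h, t)\<close>. The value at
  \<open>(h, t + 1)\<close> is a mediant of those at \<open>(h - 1, t + 1)\<close> and
  \<open>(h, t)\<close>, ordered by induction, hence at most the latter; likewise the value at
  \<open>(h + 1, t)\<close> is at least that at \<open>(h, t)\<close>. Along each axis, off the
  origin, the ratio is constant.\<close>

lemma right_start_mono:
  assumes "a > 0" "b > 0"
  shows "right_start a b h (Suc t) \<le> right_start a b (Suc h) t"
proof (induction "h + t" arbitrary: h t)
  case 0
  then show ?case using assms by (simp add: right_start_def)
next
  case (Suc n)
  note pos = path_mass_pos[OF assms assms]
  have "right_start a b h (Suc t) \<le> right_start a b h t"
  proof (cases h)
    case 0
    then obtain s where "t = Suc s" using Suc.hyps by (cases t) auto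
    then show ?thesis using 0 assms by (simp add: right_start_def)
  next
    case (Suc k)
    have "right_start a b k (Suc t) \<le> right_start a b (Suc k) t"
      using Suc.hyps Suc by simp
    then show ?thesis
      unfolding Suc right_start_def path_mass.simps(6)
      by (intro mediant_between pos) (use assms in auto)
  qed
  also have "\<dots> \<le> right_start a b (Suc h) t"
  proof (cases t)
    case 0
    then obtain s where "h = Suc s" using Suc.hyps by (cases h) auto
    then show ?thesis using 0 assms by (simp add: right_start_def)
  next
    case (Suc k)
    have "right_start a b h (Suc k) \<le> right_start a b (Suc h) k"
      using Suc.hyps Suc by simp
    then show ?thesis
      unfolding Suc right_start_def path_mass.simps(6)
      by (intro mediant_between pos) (use assms in auto)
  qed
  finally show ?case .
qed

lemma right_start_diagonal_mono:
  assumes "a > 0" "b > 0" "h \<le> m" "m \<le> n"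
  shows "right_start a b h (n - h) \<le> right_start a b m (n - m)"
  using assms(3,4)
proof (induction m rule: dec_induct)
  case (step m)
  then have "n - m = Suc (n - Suc m)" by simp
  then show ?case
    using step right_start_mono[OF assms(1,2), of m "n - Suc m"] by simp
qed simp

text \<open>Off the origin \<open>path_mass a b a b\<close> equals \<open>d\<close>, so its product
  with \<open>\<phi>\<close> is the distribution at time \<open>n\<close>. Averaging the conditional
  first-step probabilities over it recovers \<open>a * \<phi> 1 0\<close>, here divided by
  \<open>a\<close>.\<close>

lemma right_start_pairing:
  assumes "a > 0" "b > 0" "euler_harmonic a b \<phi>" "n \<ge> 1"
  shows "(\<Sum>h\<le>n. path_mass a b a b h (n - h) * \<phi> h (n - h) * right_start a b h (n - h)) = \<phi> 1 0"
    and "(\<Sum>h\<le>n. path_mass a b a b h (n - h) * \<phi> h (n - h)) = 1"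
proof -
  have "path_mass a b a b h (n - h) * right_start a b h (n - h) = path_mass a b 1 0 h (n - h)"
    if "h \<le> n" for h
    using path_mass_pos[OF assms(1,2,1,2), of h "n - h"] that assms(4)
    by (simp add: right_start_def)
  then have "(\<Sum>h\<le>n. path_mass a b a b h (n - h) * \<phi> h (n - h) * right_start a b h (n - h)) =
      (\<Sum>h\<le>n. path_mass a b 1 0 h (n - h) * \<phi> h (n - h))"
    by (intro sum.cong) (auto simp: mult_ac)
  then show "(\<Sum>h\<le>n. path_mass a b a b h (n - h) * \<phi> h (n - h) * right_start a b h (n - h)) = \<phi> 1 0"
    using path_mass_pairing[OF assms(3,4), of 1 0] by simp
  show "(\<Sum>h\<le>n. path_mass a b a b h (n - h) * \<phi> h (n - h)) = 1"
    using path_mass_pairing[OF assms(3,4), of a b] euler_harmonicD(2)[OF assms(3)]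
      euler_harmonicD(3)[OF assms(3), of 0 0] by simp
qed

section \<open>Lower bound for the first step to the right\<close>

lemma right_start_ge:
  assumes "a > 0" "b > 0" "m \<le> n" "n \<ge> 1"
  shows "real m / ((a + b) * (real m + b)) \<le> right_start a b m (n - m)"
proof -
  let ?Q = "column_fun a b m" and ?v = "path_mass a b a b"
  note Q = harmonic_column_fun[OF assms(1,2), of m]
  have "real m / ((a + b) * (real m + b)) = ?Q 1 0"
    using column_fun_right[OF assms(1,2), of m 0 0] column_fun_origin[OF assms(1,2), of m] by simp
  also have "\<dots> = (\<Sum>h\<le>n. ?v h (n - h) * ?Q h (n - h) * right_start a b h (n - h))"
    using right_start_pairing(1)[OF assms(1,2) Q assms(4)] by simp
  also have "\<dots> \<le> (\<Sum>h\<le>n. ?v h (n - h) * ?Q h (n - h) * right_start a b m (n - m))"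
  proof (rule sum_mono)
    fix h
    have "0 \<le> ?v h (n - h) * ?Q h (n - h)"
      using path_mass_nonneg[OF assms(1,2)] assms(1,2) euler_harmonicD(1)[OF Q] by simp
    moreover have "?Q h (n - h) = 0" if "m < h" using that by (simp add: column_fun_def)
    ultimately show "?v h (n - h) * ?Q h (n - h) * right_start a b h (n - h) \<le>
        ?v h (n - h) * ?Q h (n - h) * right_start a b m (n - m)"
      using right_start_diagonal_mono[OF assms(1,2) _ assms(3), of h]
      by (cases "h \<le> m") (auto intro: mult_left_mono)
  qed
  also have "\<dots> = right_start a b m (n - m)"
    using right_start_pairing(2)[OF assms(1,2) Q assms(4)] by (simp flip: sum_distrib_right)
  finally show ?thesis .
qed

text \<open>Tested against \<open>column_fun a b h\<close>: one term of a diagonal sum equal to 1 is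
  at most 1, and on its top column \<open>column_fun\<close> is a constant divided by
  \<open>(h + b)^t\<close>.\<close>

lemma path_mass_column_bound:
  assumes "a > 0" "b > 0" "h + t \<ge> 1"
  shows "path_mass a b a b h t \<le> (real h + b) ^ t / column_fun a b h h 0"
proof -
  let ?Q = "column_fun a b h" and ?v = "path_mass a b a b"
  note Q = harmonic_column_fun[OF assms(1,2), of h]
  have "?v h (h + t - h) * ?Q h (h + t - h) \<le> (\<Sum>k\<le>h + t. ?v k (h + t - k) * ?Q k (h + t - k))"
    using path_mass_nonneg[OF assms(1,2)] assms(1,2) euler_harmonicD(1)[OF Q]
    by (intro member_le_sum) auto
  then have "?v h t * ?Q h t \<le> 1"
    using right_start_pairing(2)[OF assms(1,2) Q assms(3)] by simp
  then have "?v h t * ?Q h t * (real h + b) ^ t \<le> 1 * (real h + b) ^ t"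
    using assms(2) by (intro mult_right_mono) auto
  then have "?v h t * ?Q h 0 \<le> (real h + b) ^ t"
    using column_fun_top[OF assms(1,2), of h t] by (simp add: mult.assoc)
  then show ?thesis
    using column_fun_pos[OF assms(1,2), of h h 0] by (simp add: pos_le_divide_eq)
qed

text \<open>Finitely many columns lose their mass as \<open>n\<close> grows, so nearly all mass of
  diagonal \<open>n\<close> lies at \<open>h \<ge> m\<close>, where \<open>right_start_ge\<close>
  applies. First \<open>n\<close>, then \<open>m\<close> tends to infinity.\<close>

lemma first_step_ge:
  assumes ab: "a > 0" "b > 0" and \<phi>: "euler_harmonic a b \<phi>"
    and decay: "\<And>h. (\<lambda>t. \<phi> h t * (real h + b) ^ t) \<longlonglongrightarrow> 0"
  shows "1 / (a + b) \<le> \<phi> 1 0"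
proof -
  let ?v = "path_mass a b a b"
  let ?g = "\<lambda>m. real m / ((a + b) * (real m + b))"
  have v: "0 \<le> ?v h t" for h t using path_mass_nonneg[OF ab] ab by simp
  \<comment> \<open>The probability of being in column \<open>h\<close> at time \<open>n\<close>
    tends to 0, by the growth bound for \<open>path_mass\<close>.\<close>
  have lim0: "(\<lambda>n. ?v h (n - h) * \<phi> h (n - h)) \<longlonglongrightarrow> 0" for h
  proof -
    have "(\<lambda>t. \<phi> h t * (real h + b) ^ t / column_fun a b h h 0) \<longlonglongrightarrow> 0 / column_fun a b h h 0"
      using column_fun_pos[OF ab, of h h 0] by (intro tendsto_divide decay tendsto_const) simp
    then have "(\<lambda>t. \<phi> h t * (real h + b) ^ t / column_fun a b h h 0) \<longlonglongrightarrow> 0" by simp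
    then have "(\<lambda>t. ?v h t * \<phi> h t) \<longlonglongrightarrow> 0"
    proof (rule tendsto_sandwich[OF _ _ tendsto_const, rotated -1])
      show "\<forall>\<^sub>F t in sequentially. 0 \<le> ?v h t * \<phi> h t"
        using v euler_harmonicD(1)[OF \<phi>] by simp
      show "\<forall>\<^sub>F t in sequentially. ?v h t * \<phi> h t \<le> \<phi> h t * (real h + b) ^ t / column_fun a b h h 0"
        using eventually_ge_at_top[of 1]
      proof eventually_elim
        case (elim t)
        have "?v h t * \<phi> h t \<le> (real h + b) ^ t / column_fun a b h h 0 * \<phi> h t"
          using elim by (intro mult_right_mono path_mass_column_bound[OF ab] euler_harmonicD(1)[OF \<phi>]) simp
        then show ?case unfolding times_divide_eq_left mult.commute[of "_ ^ _" "\<phi> h t"] .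
      qed
    qed
    then show ?thesis by (intro LIMSEQ_offset[of "\<lambda>n. ?v h (n - h) * \<phi> h (n - h)" h, simplified])
  qed
  have "?g m \<le> \<phi> 1 0" for m
  proof -
    \<comment> \<open>For \<open>n \<ge> m\<close> the bracket is the mass of diagonal
      \<open>n\<close> at \<open>h \<ge> m\<close>.\<close>
    have "(\<lambda>n. ?g m * (1 - (\<Sum>h<m. ?v h (n - h) * \<phi> h (n - h)))) \<longlonglongrightarrow> ?g m * (1 - (\<Sum>h<m. 0))"
      by (intro tendsto_mult tendsto_diff tendsto_const tendsto_sum lim0)
    moreover have "?g m * (1 - (\<Sum>h<m. ?v h (n - h) * \<phi> h (n - h))) \<le> \<phi> 1 0" if n: "n \<ge> Suc m" for n
    proof -
      have "1 \<le> n" "m \<le> n" using n by auto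
      have split: "{..n} = {..<m} \<union> {m..n}" using n by auto
      have nn: "0 \<le> ?v h (n - h) * \<phi> h (n - h)" for h using v euler_harmonicD(1)[OF \<phi>] by simp
      have rnn: "0 \<le> right_start a b h t" for h t
        using path_mass_nonneg[OF ab] ab by (simp add: right_start_def)
      have "1 = (\<Sum>h<m. ?v h (n - h) * \<phi> h (n - h)) + (\<Sum>h=m..n. ?v h (n - h) * \<phi> h (n - h))"
        using right_start_pairing(2)[OF ab \<phi> \<open>1 \<le> n\<close>] unfolding split
        by (subst (asm) sum.union_disjoint) auto
      then have "1 - (\<Sum>h<m. ?v h (n - h) * \<phi> h (n - h)) = (\<Sum>h=m..n. ?v h (n - h) * \<phi> h (n - h))"
        by linarith
      then have "?g m * (1 - (\<Sum>h<m. ?v h (n - h) * \<phi> h (n - h))) =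
          (\<Sum>h=m..n. ?v h (n - h) * \<phi> h (n - h)) * ?g m"
        by (simp only: mult.commute)
      also have "\<dots> = (\<Sum>h=m..n. ?v h (n - h) * \<phi> h (n - h) * ?g m)"
        by (rule sum_distrib_right)
      also have "\<dots> \<le> (\<Sum>h=m..n. ?v h (n - h) * \<phi> h (n - h) * right_start a b h (n - h))"
      proof (intro sum_mono mult_left_mono nn)
        fix h assume "h \<in> {m..n}"
        then show "?g m \<le> right_start a b h (n - h)"
          using right_start_ge[OF ab \<open>m \<le> n\<close> \<open>1 \<le> n\<close>]
            right_start_diagonal_mono[OF ab, of m h n] by simp
      qed
      also have "\<dots> \<le> (\<Sum>h\<le>n. ?v h (n - h) * \<phi> h (n - h) * right_start a b h (n - h))"
        by (intro sum_mono2 mult_nonneg_nonneg nn rnn) auto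
      also have "\<dots> = \<phi> 1 0" by (rule right_start_pairing(1)[OF ab \<phi> \<open>1 \<le> n\<close>])
      finally show ?thesis .
    qed
    then have "\<exists>N. \<forall>n\<ge>N. ?g m * (1 - (\<Sum>h<m. ?v h (n - h) * \<phi> h (n - h))) \<le> \<phi> 1 0"
      by blast
    ultimately have "?g m * (1 - (\<Sum>h<m. 0)) \<le> \<phi> 1 0"
      by (rule LIMSEQ_le_const2)
    then show ?thesis by simp
  qed
  moreover have "?g \<longlonglongrightarrow> 1 / (a + b)"
  proof -
    have "(\<lambda>m. (1 - b / (b + real m)) / (a + b)) \<longlonglongrightarrow> (1 - 0) / (a + b)"
      using ab by (intro tendsto_divide tendsto_diff tendsto_const
          real_tendsto_divide_at_top[OF tendsto_const] filterlim_real_sequentially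
          filterlim_tendsto_add_at_top[OF tendsto_const]) simp
    moreover have "(1 - b / (b + real m)) / (a + b) = ?g m" for m
    proof -
      have "b + real m \<noteq> 0" using ab by simp
      then show ?thesis by (simp add: diff_divide_eq_iff add.commute mult.commute)
    qed
    ultimately show ?thesis by simp
  qed
  ultimately show ?thesis by (intro LIMSEQ_le_const2) auto
qed

section \<open>Uniqueness by shifting the origin\<close>

definition transient :: "real \<Rightarrow> real \<Rightarrow> (nat \<Rightarrow> nat \<Rightarrow> real) \<Rightarrow> bool" where
  "transient a b \<phi> \<longleftrightarrow> (\<forall>h. (\<lambda>t. \<phi> h t * (real h + b) ^ t) \<longlonglongrightarrow> 0) \<and>
     (\<forall>t. (\<lambda>h. \<phi> h t * (real t + a) ^ h) \<longlonglongrightarrow> 0)"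

lemma transient_swap: "transient a b \<phi> \<Longrightarrow> transient b a (\<lambda>h t. \<phi> t h)"
  by (simp add: transient_def)

lemma transient_first_step:
  assumes "a > 0" "b > 0" "euler_harmonic a b \<phi>" "transient a b \<phi>"
  shows "\<phi> 1 0 = 1 / (a + b)"
proof -
  have 1: "1 / (a + b) \<le> \<phi> 1 0" using assms by (intro first_step_ge) (auto simp: transient_def)
  have "1 / (b + a) \<le> \<phi> 0 1"
    using first_step_ge[OF assms(2,1) euler_harmonic_swap[OF assms(3)]] assms(4)
    by (simp add: transient_def)
  then have "b * (1 / (a + b)) \<le> b * \<phi> 0 1"
    using assms(2) by (intro mult_left_mono) (auto simp: add.commute)
  moreover have "1 = a * \<phi> 1 0 + b * \<phi> 0 1"
    using euler_harmonicD(2)[OF assms(3)] euler_harmonicD(3)[OF assms(3), of 0 0] by simp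
  moreover have "a * (1 / (a + b)) + b * (1 / (a + b)) = 1"
    using assms(1,2) by (simp flip: add_divide_distrib)
  ultimately have "a * \<phi> 1 0 \<le> a * (1 / (a + b))" by linarith
  then have "\<phi> 1 0 \<le> 1 / (a + b)" using assms(1) by (simp only: mult_le_cancel_left_pos)
  with 1 show ?thesis by simp
qed

lemma transient_unique:
  assumes "a > 0" "b > 0" "euler_harmonic a b \<phi>" "transient a b \<phi>"
  shows "\<phi> h t = star_fun a b h t"
  using assms
\<comment> \<open>The parameters stay arbitrary because the shift changes them.\<close>
proof (induction "h + t" arbitrary: a b \<phi> h t)
  case 0
  then show ?case by (simp add: star_fun_def euler_harmonicD(2))
next
  case (Suc n)
  have right: "\<phi> (Suc k) t = star_fun a b (Suc k) t"
    if ab: "a > 0" "b > 0" and \<phi>: "euler_harmonic a b \<phi>" "transient a b \<phi>" and n: "n = k + t"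
    for a b :: real and \<phi> :: "nat \<Rightarrow> nat \<Rightarrow> real" and k t :: nat
  proof -
    \<comment> \<open>\<open>\<phi>\<close> seen from \<open>(1, 0)\<close>, normalised by
      \<open>\<phi> 1 0 = 1 / (a + b)\<close>. Moving one column to the right turns
      \<open>h + b\<close> into \<open>h + (b + 1)\<close>.\<close>
    define \<psi> where "\<psi> h t = (a + b) * \<phi> (Suc h) t" for h t
    have h: "euler_harmonic a (b + 1) \<psi>"
    proof (rule euler_harmonicI)
      show "0 \<le> \<psi> h t" for h t using euler_harmonicD(1)[OF \<phi>(1)] ab by (simp add: \<psi>_def)
      show "\<psi> 0 0 = 1" using transient_first_step[OF ab \<phi>] ab by (simp add: \<psi>_def)
      show "\<psi> h t = (real t + a) * \<psi> (Suc h) t + (real h + (b + 1)) * \<psi> h (Suc t)" for h t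
        unfolding \<psi>_def using euler_harmonicD(3)[OF \<phi>(1), of "Suc h" t] by (simp add: algebra_simps)
    qed
    have col: "(\<lambda>t. \<psi> h t * (real h + (b + 1)) ^ t) \<longlonglongrightarrow> 0" for h
    proof -
      have "(\<lambda>t. (a + b) * (\<phi> (Suc h) t * (real (Suc h) + b) ^ t)) \<longlonglongrightarrow> (a + b) * 0"
        using \<phi>(2) unfolding transient_def by (intro tendsto_mult tendsto_const) blast
      then show ?thesis by (simp add: \<psi>_def add_ac mult_ac)
    qed
    have row: "(\<lambda>h. \<psi> h t * (real t + a) ^ h) \<longlonglongrightarrow> 0" for t
    proof -
      \<comment> \<open>The constant compensates the extra power of \<open>t + a\<close> brought in
        by the shift.\<close>
      have "(\<lambda>h. (a + b) / (real t + a) * (\<phi> (Suc h) t * (real t + a) ^ Suc h))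
          \<longlonglongrightarrow> (a + b) / (real t + a) * 0"
        using \<phi>(2) unfolding transient_def
        by (intro tendsto_mult tendsto_const LIMSEQ_Suc) blast
      moreover have "(a + b) / (real t + a) * (\<phi> (Suc h) t * (real t + a) ^ Suc h) =
          \<psi> h t * (real t + a) ^ h" for h
        using ab by (simp add: \<psi>_def)
      ultimately show ?thesis by simp
    qed
    have "\<psi> k t = star_fun a (b + 1) k t"
      using Suc.hyps(1)[OF n ab(1) _ h] ab(2) col row by (simp add: transient_def)
    moreover have "star_fun a b (Suc k) t = star_fun a (b + 1) k t / (a + b)"
      by (simp add: star_fun_def pochhammer_rec add_ac)
    moreover have "a + b \<noteq> 0" using ab by simp
    ultimately show ?thesis unfolding \<psi>_def by (metis nonzero_mult_div_cancel_left)
  qed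
  show ?case
  proof (cases h)
    case (Suc k)
    then show ?thesis using right[of a b \<phi> k t] Suc.hyps Suc.prems \<open>Suc n = h + t\<close> by simp
  next
    case 0
    \<comment> \<open>On this axis the path starts upwards; reflection leads back to
      \<open>right\<close>.\<close>
    then obtain k where "t = Suc k" using \<open>Suc n = h + t\<close> by (cases t) auto
    then show ?thesis
      using right[of b a "\<lambda>h t. \<phi> t h" k 0] Suc.prems \<open>Suc n = h + t\<close> 0
        euler_harmonic_swap transient_swap by (simp add: star_fun_def add.commute)
  qed
qed


subsection \<open>The extreme harmonic functions\<close>

text \<open>Reduces extremality of \<open>\<phi>\<close> to showing that every harmonic function
  below a multiple of \<open>\<phi>\<close> is \<open>\<phi>\<close> itself.\<close>

lemma harmonic_split_bounds:
  assumes "euler_harmonic a b \<phi>1" "euler_harmonic a b \<phi>2" "0 < u" "u < 1"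
    and "\<And>h t. \<phi> h t = (1 - u) * \<phi>1 h t + u * \<phi>2 h t"
  shows "\<phi>1 h t \<le> 1 / (1 - u) * \<phi> h t" "\<phi>2 h t \<le> 1 / u * \<phi> h t"
  using euler_harmonicD(1)[OF assms(1), of h t] euler_harmonicD(1)[OF assms(2), of h t] assms(3,4)
  by (simp_all add: assms(5) pos_le_divide_eq mult.commute)

context
  fixes a b :: real
  assumes ab: "a > 0" "b > 0"
begin

text \<open>Domination makes \<open>\<phi>\<close> vanish right of column \<open>m\<close>, so its
  normalised values on that column are constant. The minimum principle in both directions makes
  \<open>\<phi>\<close> a multiple of \<open>column_fun\<close>, and the origin gives the factor
  1.\<close>

lemma dominated_by_column_fun:
  assumes \<phi>: "euler_harmonic a b \<phi>" and le: "\<And>h t. \<phi> h t \<le> K * column_fun a b m h t"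
  shows "\<phi> = column_fun a b m"
proof -
  note Q = harmonic_column_fun[OF ab, of m] and \<phi>_nn = euler_harmonicD(1)[OF \<phi>]
  have zero: "\<phi> h t = 0" if "m < h" for h t
    using le[of h t] \<phi>_nn[of h t] that by (simp add: column_fun_def)
  have top: "\<phi> m t * (real m + b) ^ t = \<phi> m 0" for t
  proof (induction t)
    case (Suc t)
    then show ?case
      using euler_harmonicD(3)[OF \<phi>, of m t] zero[of "Suc m" t] by (simp add: mult_ac)
  qed simp
  define c where "c = \<phi> m 0 / column_fun a b m m 0"
  have Q0: "column_fun a b m m 0 > 0" using column_fun_pos[OF ab, of m m 0] by simp
  have ge: "c * column_fun a b m h t \<le> \<phi> h t" for h t
    unfolding c_def using top \<phi>_nn by (intro column_fun_le[OF ab \<phi>]) auto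
  \<comment> \<open>For the inequality opposite to \<open>ge\<close>, the lower bound comes from the
    domination.\<close>
  let ?\<psi> = "\<lambda>h t. c * column_fun a b m h t - \<phi> h t"
  have "0 \<le> ?\<psi> h t" for h t
  proof (rule superharmonic_nonneg[OF ab, where m = m and Q = "column_fun a b m" and C = K])
    fix h t
    have "p * (c * x' - x) + q * (c * y' - y) = c * (p * x' + q * y') - (p * x + q * y)"
      for p q x x' y y' :: real
      by (simp add: algebra_simps)
    then show "(real t + a) * ?\<psi> (Suc h) t + (real h + b) * ?\<psi> h (Suc t) \<le> ?\<psi> h t"
      using euler_harmonicD(3)[OF \<phi>, of h t] euler_harmonicD(3)[OF Q, of h t] by simp
    have "0 \<le> c * column_fun a b m h t"
      using Q0 \<phi>_nn[of m 0] euler_harmonicD(1)[OF Q, of h t] by (simp add: c_def)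
    then show "- K * column_fun a b m h t \<le> ?\<psi> h t"
      using le[of h t] by simp
    show "0 \<le> ?\<psi> h t" if "m \<le> h"
    proof (cases "h = m")
      case True
      have "c * (column_fun a b m m t * (real m + b) ^ t) = \<phi> m t * (real m + b) ^ t"
        using Q0 unfolding column_fun_top[OF ab] top by (simp add: c_def)
      then have "c * column_fun a b m m t * (real m + b) ^ t = \<phi> m t * (real m + b) ^ t"
        by (simp add: mult.assoc)
      then show ?thesis using ab by (simp add: True)
    next
      case False
      then show ?thesis using that zero[of h t] by (simp add: column_fun_def)
    qed
  qed (rule column_fun_decay[OF ab])
  then have eq: "\<phi> h t = c * column_fun a b m h t" for h t
    using ge[of h t] by (simp add: order_antisym)
  have "c = 1"
    using eq[of 0 0] column_fun_origin[OF ab] euler_harmonicD(2)[OF \<phi>] by simp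
  then show ?thesis using eq by (intro ext) simp
qed

lemma extreme_column_fun:
  "extreme_harmonic (euler_w1 a) (euler_w0 b) (column_fun a b m)"
  unfolding extreme_harmonic_def
  using harmonic_column_fun[OF ab] dominated_by_column_fun harmonic_split_bounds by metis

lemma transient_star_fun: "transient a b (star_fun a b)"
  using star_fun_decay[OF ab] star_fun_decay[OF ab(2,1)]
  by (simp add: transient_def star_fun_def add.commute)

lemma transient_mono:
  assumes \<phi>: "euler_harmonic a b \<phi>" and \<eta>: "transient a b \<eta>"
    and le: "\<And>h t. \<phi> h t \<le> K * \<eta> h t"
  shows "transient a b \<phi>"
proof -
  have decay: "(\<lambda>k. f k * x ^ k) \<longlonglongrightarrow> 0"
    if "(\<lambda>k. g k * x ^ k) \<longlonglongrightarrow> 0" "\<And>k. 0 \<le> f k" "\<And>k. f k \<le> K * g k" "0 < x"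
    for f g :: "nat \<Rightarrow> real" and x
  proof -
    have "(\<lambda>k. K * (g k * x ^ k)) \<longlonglongrightarrow> K * 0" by (intro tendsto_mult tendsto_const that(1))
    then have "(\<lambda>k. K * (g k * x ^ k)) \<longlonglongrightarrow> 0" by simp
    then show ?thesis
      by (rule tendsto_sandwich[OF _ _ tendsto_const, rotated -1])
        (use that in \<open>auto simp flip: mult.assoc intro!: mult_right_mono\<close>)
  qed
  show ?thesis
    unfolding transient_def
  proof (intro conjI allI)
    show "(\<lambda>t. \<phi> h t * (real h + b) ^ t) \<longlonglongrightarrow> 0" for h
      by (rule decay[of "\<eta> h"]) (use \<eta> le euler_harmonicD(1)[OF \<phi>] ab in \<open>auto simp: transient_def\<close>)
    show "(\<lambda>h. \<phi> h t * (real t + a) ^ h) \<longlonglongrightarrow> 0" for t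
      by (rule decay[of "\<lambda>h. \<eta> h t"])
        (use \<eta> le euler_harmonicD(1)[OF \<phi>] ab in \<open>auto simp: transient_def\<close>)
  qed
qed

text \<open>A harmonic function below a multiple of \<open>star_fun\<close> inherits its decay, so
  \<open>transient_unique\<close> applies to it.\<close>

lemma extreme_star_fun:
  "extreme_harmonic (euler_w1 a) (euler_w0 b) (star_fun a b)"
proof -
  have "\<phi> = star_fun a b"
    if "euler_harmonic a b \<phi>" "\<And>h t. \<phi> h t \<le> K * star_fun a b h t" for \<phi> K
    using transient_unique[OF ab that(1) transient_mono[OF that(1) transient_star_fun that(2)]]
    by (intro ext)
  then show ?thesis
    unfolding extreme_harmonic_def
    using harmonic_star_fun[OF ab] harmonic_split_bounds by metis
qed

text \<open>A positive limit would make \<open>\<phi>\<close> dominate a positive multiple of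
  \<open>column_fun\<close>. Splitting off part of it is a convex decomposition, so extremality
  would force \<open>\<phi>\<close> to be \<open>column_fun\<close>.\<close>

lemma extreme_column_limit:
  assumes ex: "extreme_harmonic (euler_w1 a) (euler_w0 b) \<phi>"
    and ne: "\<phi> \<noteq> column_fun a b h"
  shows "(\<lambda>t. \<phi> h t * (real h + b) ^ t) \<longlonglongrightarrow> 0"
proof -
  have \<phi>: "euler_harmonic a b \<phi>" using ex by (simp add: extreme_harmonic_def)
  obtain L where L: "0 \<le> L" "(\<lambda>t. \<phi> h t * (real h + b) ^ t) \<longlonglongrightarrow> L"
    "\<And>t. L \<le> \<phi> h t * (real h + b) ^ t"
    using column_limit[OF ab \<phi>, of h] by metis
  have "L = 0"
  proof (rule ccontr)
    assume "L \<noteq> 0"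
    let ?Q = "column_fun a b h"
    note Q = harmonic_column_fun[OF ab, of h]
    define c where "c = L / ?Q h 0"
    have "0 < ?Q h 0" using column_fun_pos[OF ab, of h h 0] by simp
    then have "c > 0" using \<open>L \<noteq> 0\<close> L(1) by (simp add: c_def)
    have ge: "c * ?Q k t \<le> \<phi> k t" for k t
      unfolding c_def using L by (intro column_fun_le[OF ab \<phi>]) auto
    then have "c \<le> 1"
      using euler_harmonicD(2)[OF \<phi>] column_fun_origin[OF ab] by (metis mult.right_neutral)
    \<comment> \<open>Half of \<open>c\<close>, because \<open>c = 1\<close> would leave nothing to split off.\<close>
    define u where "u = c / 2"
    have u: "0 < u" "u < 1" using \<open>c > 0\<close> \<open>c \<le> 1\<close> by (auto simp: u_def)
    have ge': "u * ?Q k t \<le> \<phi> k t" for k t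
    proof -
      have "u * ?Q k t \<le> c * ?Q k t"
        using \<open>c > 0\<close> euler_harmonicD(1)[OF Q] by (intro mult_right_mono) (auto simp: u_def)
      then show ?thesis using ge[of k t] by simp
    qed
    define \<psi> where "\<psi> k t = (\<phi> k t - u * ?Q k t) / (1 - u)" for k t
    have "euler_harmonic a b \<psi>"
    proof (rule euler_harmonicI)
      show "0 \<le> \<psi> k t" for k t using ge'[of k t] u by (simp add: \<psi>_def)
      show "\<psi> 0 0 = 1"
        using u euler_harmonicD(2)[OF \<phi>] column_fun_origin[OF ab] by (simp add: \<psi>_def)
      show "\<psi> k t = (real t + a) * \<psi> (Suc k) t + (real k + b) * \<psi> k (Suc t)" for k t
      proof -
        have "p * ((x - u * x') / (1 - u)) + q * ((y - u * y') / (1 - u)) =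
            ((p * x + q * y) - u * (p * x' + q * y')) / (1 - u)" for p q x x' y y' :: real
          by (simp add: algebra_simps flip: add_divide_distrib)
        then show ?thesis
          unfolding \<psi>_def
          using euler_harmonicD(3)[OF \<phi>, of k t] euler_harmonicD(3)[OF Q, of k t] by simp
      qed
    qed
    moreover have split: "\<phi> k t = (1 - u) * \<psi> k t + u * ?Q k t" for k t
      using u by (simp add: \<psi>_def)
    ultimately have "\<psi> = ?Q" using ex Q u unfolding extreme_harmonic_def by blast
    then have "\<phi> k t = ?Q k t" for k t using split[of k t] by (simp add: algebra_simps)
    then show False using ne by (metis ext)
  qed
  then show ?thesis using L(2) by simp
qed

end

theorem extreme_euler_harmonic_iff:
  assumes ab: "a > 0" "b > 0"
  shows "extreme_harmonic (euler_w1 a) (euler_w0 b) \<phi> \<longleftrightarrow>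
    (\<exists>m. \<phi> = column_fun a b m) \<or> (\<exists>m. \<phi> = (\<lambda>h t. column_fun b a m t h)) \<or> \<phi> = star_fun a b"
    (is "?l \<longleftrightarrow> ?r")
proof
  assume ex: ?l
  show ?r
  proof (rule ccontr)
    assume n: "\<not> ?r"
    have "(\<lambda>t. \<phi> h t * (real h + b) ^ t) \<longlonglongrightarrow> 0" for h
      using n by (intro extreme_column_limit[OF ab ex]) auto
    moreover have "(\<lambda>h. \<phi> h t * (real t + a) ^ h) \<longlonglongrightarrow> 0" for t
    proof (rule extreme_column_limit[OF ab(2,1) extreme_euler_harmonic_swap[OF ex]])
      show "(\<lambda>h t. \<phi> t h) \<noteq> column_fun b a t"
      proof
        assume "(\<lambda>h t. \<phi> t h) = column_fun b a t"
        then have "\<phi> = (\<lambda>h t'. column_fun b a t t' h)" by (metis ext)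
        then show False using n by blast
      qed
    qed
    ultimately have "transient a b \<phi>" by (simp add: transient_def)
    moreover have "euler_harmonic a b \<phi>" using ex by (simp add: extreme_harmonic_def)
    ultimately have "\<phi> = star_fun a b" using transient_unique[OF ab] by (intro ext)
    with n show False by blast
  qed
next
  assume ?r
  then show ?l
    using extreme_column_fun[OF ab] extreme_star_fun[OF ab]
      extreme_euler_harmonic_swap[OF extreme_column_fun[OF ab(2,1)]] by auto
qed


subsection \<open>The boundary\<close>

text \<open>Consecutive Pochhammer symbols differ by the factor \<open>a + b + h + t\<close>. This
  identifies \<open>P_star\<close> as the law with probability function
  \<open>star_fun\<close>.\<close>

lemma harmonic_step_star_fun:
  assumes "a > 0" "b > 0"
  shows "harmonic_step (euler_w1 a) (star_fun a b) = euler_step a b"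
proof -
  have "euler_w1 a h t * star_fun a b (Suc h) t / star_fun a b h t =
      (real t + a) / (real h + real t + a + b)" for h t
    using pochhammer_ab_pos[OF assms, of "h + t"]
    by (simp add: euler_w1_def star_fun_def pochhammer_Suc add_ac)
  then show ?thesis by (auto simp: harmonic_step_def euler_step_def)
qed

theorem proposition12:
  fixes a b :: real
  assumes "a > 0" and "b > 0"
  shows "(\<forall>m. \<exists>!Q. is_Q_m_inf (euler_w1 a) (euler_w0 b) m Q) \<and>
    (\<forall>m. \<exists>!Q. is_Q_inf_m (euler_w1 a) (euler_w0 b) m Q) \<and>
    extreme_measures (path_laws (euler_w1 a) (euler_w0 b)) =
      range (Q_m_inf (euler_w1 a) (euler_w0 b)) \<union>
      range (Q_inf_m (euler_w1 a) (euler_w0 b)) \<union>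
      {P_star a b}"
proof -
  let ?w1 = "euler_w1 a" and ?w0 = "euler_w0 b"
  let ?row = "\<lambda>m h t. column_fun b a m t h"
  interpret positive_weights ?w1 ?w0
    by unfold_locales (use assms in \<open>auto simp: euler_w1_def euler_w0_def\<close>)
  note iff = extreme_euler_harmonic_iff[OF assms]
  have law: "\<exists>!P. P \<in> path_laws ?w1 ?w0 \<and> prob_fun ?w1 ?w0 P = \<phi>" if "euler_harmonic a b \<phi>" for \<phi>
    using cylinder_law_exists[OF that] cylinder_law_imp_path_law path_laws_eqI by metis
  have ext: "P \<in> extreme_measures (path_laws ?w1 ?w0) \<longleftrightarrow> P \<in> path_laws ?w1 ?w0 \<and>
      ((\<exists>m. prob_fun ?w1 ?w0 P = column_fun a b m) \<or> (\<exists>m. prob_fun ?w1 ?w0 P = ?row m) \<or>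
        prob_fun ?w1 ?w0 P = star_fun a b)" for P
    unfolding extreme_measures_iff iff ..
  have col_pos: "column_fun a b m h t > 0 \<longleftrightarrow> h \<le> m" for m h t
    using column_fun_pos[OF assms, of h m t] by (auto simp: column_fun_def)
  have row_pos: "?row m h t > 0 \<longleftrightarrow> t \<le> m" for m h t
    using column_fun_pos[OF assms(2,1), of t m h] by (auto simp: column_fun_def)
  have star_pos: "star_fun a b h t > 0" for h t by (rule star_fun_pos[OF assms])
  \<comment> \<open>Of the candidates in \<open>ext\<close>, a row function is positive at
    \<open>(m + 1, 0)\<close> and \<open>star_fun\<close> everywhere, so the required support leaves
    only \<open>column_fun a b m\<close>.\<close>
  have Q1: "is_Q_m_inf ?w1 ?w0 m P \<longleftrightarrow>
      P \<in> path_laws ?w1 ?w0 \<and> prob_fun ?w1 ?w0 P = column_fun a b m" for m P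
  proof
    assume Q: "is_Q_m_inf ?w1 ?w0 m P"
    then have pos: "prob_fun ?w1 ?w0 P h t > 0 \<longleftrightarrow> h \<le> m" for h t
      by (cases "h \<le> m") (auto simp: is_Q_m_inf_def)
    have P: "P \<in> extreme_measures (path_laws ?w1 ?w0)" using Q by (simp add: is_Q_m_inf_def)
    then consider k where "prob_fun ?w1 ?w0 P = column_fun a b k"
      | k where "prob_fun ?w1 ?w0 P = ?row k" | "prob_fun ?w1 ?w0 P = star_fun a b"
      unfolding ext by blast
    then show "P \<in> path_laws ?w1 ?w0 \<and> prob_fun ?w1 ?w0 P = column_fun a b m"
    proof cases
      case (1 k)
      then have "h \<le> k \<longleftrightarrow> h \<le> m" for h using pos[of h 0] by (simp add: col_pos)
      then have "k = m" by (meson order_antisym order_refl)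
      then show ?thesis using 1 P by (simp add: ext)
    next
      case (2 k)
      then show ?thesis using pos[of "Suc m" 0] by (simp add: row_pos)
    next
      case 3
      then show ?thesis using pos[of "Suc m" 0] by (simp add: star_pos)
    qed
  next
    assume "P \<in> path_laws ?w1 ?w0 \<and> prob_fun ?w1 ?w0 P = column_fun a b m"
    then show "is_Q_m_inf ?w1 ?w0 m P"
      using col_pos[of m] by (auto simp: is_Q_m_inf_def ext) (simp add: column_fun_def)
  qed
  have Q2: "is_Q_inf_m ?w1 ?w0 m P \<longleftrightarrow>
      P \<in> path_laws ?w1 ?w0 \<and> prob_fun ?w1 ?w0 P = ?row m" for m P
  proof
    assume Q: "is_Q_inf_m ?w1 ?w0 m P"
    then have pos: "prob_fun ?w1 ?w0 P h t > 0 \<longleftrightarrow> t \<le> m" for h t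
      by (cases "t \<le> m") (auto simp: is_Q_inf_m_def)
    have P: "P \<in> extreme_measures (path_laws ?w1 ?w0)" using Q by (simp add: is_Q_inf_m_def)
    then consider k where "prob_fun ?w1 ?w0 P = column_fun a b k"
      | k where "prob_fun ?w1 ?w0 P = ?row k" | "prob_fun ?w1 ?w0 P = star_fun a b"
      unfolding ext by blast
    then show "P \<in> path_laws ?w1 ?w0 \<and> prob_fun ?w1 ?w0 P = ?row m"
    proof cases
      case (1 k)
      then show ?thesis using pos[of 0 "Suc m"] by (simp add: col_pos)
    next
      case (2 k)
      then have "t \<le> k \<longleftrightarrow> t \<le> m" for t using pos[of 0 t] by (simp add: row_pos)
      then have "k = m" by (meson order_antisym order_refl)
      then show ?thesis using 2 P by (simp add: ext)
    next
      case 3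
      then show ?thesis using pos[of 0 "Suc m"] by (simp add: star_pos)
    qed
  next
    assume "P \<in> path_laws ?w1 ?w0 \<and> prob_fun ?w1 ?w0 P = ?row m"
    then show "is_Q_inf_m ?w1 ?w0 m P"
      using row_pos[of m] by (auto simp: is_Q_inf_m_def ext) (simp add: column_fun_def)
  qed
  have ex1: "\<exists>!Q. is_Q_m_inf ?w1 ?w0 m Q" for m
    unfolding Q1 by (rule law[OF harmonic_column_fun[OF assms]])
  have ex2: "\<exists>!Q. is_Q_inf_m ?w1 ?w0 m Q" for m
    unfolding Q2 by (rule law[OF euler_harmonic_swap[OF harmonic_column_fun[OF assms(2,1)]]])
  have "is_markov_chain_law (0, 0) (harmonic_step ?w1 (star_fun a b)) (P_star a b)"
    unfolding harmonic_step_star_fun[OF assms] P_star_def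
    by (rule is_markov_chain_law_markov_chain_law)
  then have "cylinder_law ?w1 ?w0 (star_fun a b) (P_star a b)"
    by (simp add: cylinder_law_iff_markov harmonic_star_fun[OF assms])
  note star = cylinder_law_imp_path_law[OF this]
  \<comment> \<open>Unique existence turns the definite description into a characterisation by
    \<open>prob_fun\<close>, which matches one of the families in \<open>ext\<close>.\<close>
  have "P = Q_m_inf ?w1 ?w0 m \<longleftrightarrow> is_Q_m_inf ?w1 ?w0 m P" for P m
    unfolding Q_m_inf_def using theI'[OF ex1[of m]] ex1[of m] by blast
  moreover have "P = Q_inf_m ?w1 ?w0 m \<longleftrightarrow> is_Q_inf_m ?w1 ?w0 m P" for P m
    unfolding Q_inf_m_def using theI'[OF ex2[of m]] ex2[of m] by blast
  moreover have "P = P_star a b \<longleftrightarrow> P \<in> path_laws ?w1 ?w0 \<and> prob_fun ?w1 ?w0 P = star_fun a b" for P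
    using star path_laws_eqI by metis
  ultimately have "P \<in> extreme_measures (path_laws ?w1 ?w0) \<longleftrightarrow>
      P \<in> range (Q_m_inf ?w1 ?w0) \<union> range (Q_inf_m ?w1 ?w0) \<union> {P_star a b}" for P
    unfolding ext image_iff Un_iff singleton_iff Q1 Q2 by blast
  then show ?thesis using ex1 ex2 by blast
qed

end
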